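(* Let $A$ be an $n\times n$ alternating sign matrix and let $\delta$ be its Dyck island. Suppose the boundary paths of $\delta$ consist of the loops $\gamma_1,\ldots,\gamma_\ell$ (possibly nested), and let $k$ be the total number of off-diagonal osculations. Then \[ \operatorname{inv}(A)=\operatorname{inv}(\delta)=\sum_{t=1}^{\ell}\operatorname{inv}(\gamma_t)-k . \]
   Context: An alternating sign matrix (ASM) of size $n$ is an $n\times n$ matrix with entries in $\{0,1,-1\}$ such that every row and every column sums to $1$ and the nonzero entries alternate in sign along each row and each column. Its inversion number is $\operatorname{inv}(A)=\sum A_{ij}A_{i'j'}$, the sum over all $1\le i,i',j,j'\le n$ with $i>i'$ and $j<j'$. The height function of $A$ is $h_{ij}=i+j-2\sum_{i'\le i}\sum_{j'\le j}A_{i'j'}$ for $0\le i,j\le n$ (empty sums are $0$). Let $h^{(0)}$ be the height function of the identity matrix, so $h^{(0)}_{ij}=|i-j|$. The Dyck island of $A$ is the $(n-1)\times(n-1)$ array of nonnegative integers $\delta_{ij}=\tfrac12(h_{ij}-h^{(0)}_{ij})$, $1\le i,j\le n-1$. Geometric picture. Attach $A_{ij}$ to the lattice point $(i,j)$, $1\le i,j\le n$, where the row index $i$ increases downward and the column index $j$ increases to the right. The value $\delta_{ij}$ is written in the unit box with corners $(i,j),(i+1,j),(i,j+1),(i+1,j+1)$. Boxes outside the array are regarded as having value $0$. The diagonal is the set of lattice points $(i,i)$. Boundary paths. Consider the set of unit lattice edges that separate two boxes with different $\delta$-values; adjacent values differ by at most $1$. This set is decomposed into closed lattice loops $\gamma_1,\dots,\gamma_\ell$,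 each of the following form. There are diagonal points $(a,a)$ and $(b,b)$ with $a<b$ such that: - The northeast boundary $\mathrm{neb}(\gamma)$ is a lattice path from $(a,a)$ to $(b,b)$ using unit steps right (letter $u$) and down (letter $d$). It stays in the region $\{j\ge i\}$. - The southwest boundary $\mathrm{swb}(\gamma)$ is a lattice path from $(a,a)$ to $(b,b)$ using unit steps down (letter $u$) and right (letter $d$). It stays in $\{i\ge j\}$. Thus both paths are Dyck paths, with $u$ a step away from the diagonal and $d$ a step toward it. The semilength of $\gamma$ is $b-a$. Distinct paths in the decomposition share no edges, only isolated lattice points. By convention, a loop whose northeast and southwest boundaries meet at diagonal points strictly between its endpoints is kept as a single loop and is not split. Each $\delta_{ij}$ equals the number of loops $\gamma_t$ enclosing box $(i,j)$. For a single such loop $\gamma$, let $A_\gamma$ be the ASM whose Dyck island is $1$ on the boxes enclosed by $\gamma$ and $0$ elsewhere, and set $\operatorname{inv}(\gamma)=\operatorname{inv}(A_\gamma)$. An off-diagonal osculation is a lattice point not on the diagonal that lies on two distinct loops $\gamma_s,\gamma_t$ ($s\neq t$).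
   Formalization: The loops are additionally required to be non-crossing: the regions enclosed by any two loops are nested or disjoint. Without this the listed properties allow crossing decompositions for which the formula fails (an example exists for n = 6). *)

theory Defs
  imports "Jordan_Normal_Form.Matrix"
begin

(* Matrices are indexed from 0, so the entry attached to the lattice point (i, j), 1 <= i, j <= n,
   is A $$ (i - 1, j - 1). Lattice points and boxes are indexed from 1. *)

definition asm :: "nat \<Rightarrow> int mat \<Rightarrow> bool" where
  "asm n A \<longleftrightarrow>
     A \<in> carrier_mat n n \<and>
     (\<forall>i<n. \<forall>j<n. A $$ (i, j) \<in> {0, 1, -1}) \<and>
     (\<forall>i<n. (\<Sum>j<n. A $$ (i, j)) = 1) \<and>
     (\<forall>j<n. (\<Sum>i<n. A $$ (i, j)) = 1) \<and>
     (\<forall>i<n. \<forall>j<n. \<forall>j'<j. A $$ (i, j') \<noteq> 0 \<and> A $$ (i, j) \<noteq> 0 \<and>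
        (\<forall>l\<in>{j'<..<j}. A $$ (i, l) = 0) \<longrightarrow> A $$ (i, j) = - A $$ (i, j')) \<and>
     (\<forall>j<n. \<forall>i<n. \<forall>i'<i. A $$ (i', j) \<noteq> 0 \<and> A $$ (i, j) \<noteq> 0 \<and>
        (\<forall>l\<in>{i'<..<i}. A $$ (l, j) = 0) \<longrightarrow> A $$ (i, j) = - A $$ (i', j))"

definition asm_inv :: "nat \<Rightarrow> int mat \<Rightarrow> int" where
  "asm_inv n A = (\<Sum>i<n. \<Sum>i'<i. \<Sum>j'<n. \<Sum>j<j'. A $$ (i, j) * A $$ (i', j'))"

definition height :: "int mat \<Rightarrow> nat \<Rightarrow> nat \<Rightarrow> int" where
  "height A i j = int i + int j - 2 * (\<Sum>i'<i. \<Sum>j'<j. A $$ (i', j'))"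

(* The difference of two height functions is even, so div is exact here.
   The value is extended by 0 to the boxes outside the array. *)
definition dyck_island :: "nat \<Rightarrow> int mat \<Rightarrow> nat \<Rightarrow> nat \<Rightarrow> int" where
  "dyck_island n A i j =
     (if i \<in> {1..<n} \<and> j \<in> {1..<n} then (height A i j - height (1\<^sub>m n) i j) div 2 else 0)"

definition asm_of_island :: "nat \<Rightarrow> (nat \<Rightarrow> nat \<Rightarrow> int) \<Rightarrow> int mat" where
  "asm_of_island n \<delta> =
     (THE A. asm n A \<and> (\<forall>i\<in>{1..<n}. \<forall>j\<in>{1..<n}. dyck_island n A i j = \<delta> i j))"

definition island_inv :: "nat \<Rightarrow> (nat \<Rightarrow> nat \<Rightarrow> int) \<Rightarrow> int" where
  "island_inv n \<delta> = asm_inv n (asm_of_island n \<delta>)"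

type_synonym point = "nat \<times> nat"

(* Box (i, j) has corners (i, j), (i+1, j), (i, j+1), (i+1, j+1). Boxes with i = 0 or j = 0 lie
   outside the array and have value 0, so the shifted indices below reach every pair of
   neighbouring boxes that can differ. *)
definition boundary_edges :: "(nat \<Rightarrow> nat \<Rightarrow> int) \<Rightarrow> point set set" where
  "boundary_edges \<delta> =
     {{(i, j + 1), (i + 1, j + 1)} | i j. \<delta> i j \<noteq> \<delta> i (j + 1)} \<union>
     {{(i + 1, j), (i + 1, j + 1)} | i j. \<delta> i j \<noteq> \<delta> (i + 1) j}"

(* U is a step away from the diagonal, D a step toward it: on the northeast boundary U means
   right and D means down; on the southwest boundary U means down and D means right. *)
datatype step = U | D

definition dyck_word :: "nat \<Rightarrow> step list \<Rightarrow> bool" where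
  "dyck_word m w \<longleftrightarrow>
     count_list w U = m \<and> count_list w D = m \<and>
     (\<forall>k\<le>length w. count_list (take k w) D \<le> count_list (take k w) U)"

(* A loop from (start, start) to (stop, stop), given by the words of its two boundaries. *)
datatype dyck_loop =
  Loop (start: nat) (stop: nat) (neb: "step list") (swb: "step list")

definition is_loop :: "nat \<Rightarrow> dyck_loop \<Rightarrow> bool" where
  "is_loop n \<gamma> \<longleftrightarrow>
     1 \<le> start \<gamma> \<and> start \<gamma> < stop \<gamma> \<and> stop \<gamma> \<le> n \<and>
     dyck_word (stop \<gamma> - start \<gamma>) (neb \<gamma>) \<and> dyck_word (stop \<gamma> - start \<gamma>) (swb \<gamma>)"

definition neb_vertex :: "dyck_loop \<Rightarrow> nat \<Rightarrow> point" where
  "neb_vertex \<gamma> k =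
     (start \<gamma> + count_list (take k (neb \<gamma>)) D, start \<gamma> + count_list (take k (neb \<gamma>)) U)"

definition swb_vertex :: "dyck_loop \<Rightarrow> nat \<Rightarrow> point" where
  "swb_vertex \<gamma> k =
     (start \<gamma> + count_list (take k (swb \<gamma>)) U, start \<gamma> + count_list (take k (swb \<gamma>)) D)"

definition loop_points :: "dyck_loop \<Rightarrow> point set" where
  "loop_points \<gamma> = neb_vertex \<gamma> ` {..length (neb \<gamma>)} \<union> swb_vertex \<gamma> ` {..length (swb \<gamma>)}"

definition neb_edges :: "dyck_loop \<Rightarrow> point set set" where
  "neb_edges \<gamma> = {{neb_vertex \<gamma> k, neb_vertex \<gamma> (Suc k)} | k. k < length (neb \<gamma>)}"

definition swb_edges :: "dyck_loop \<Rightarrow> point set set" where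
  "swb_edges \<gamma> = {{swb_vertex \<gamma> k, swb_vertex \<gamma> (Suc k)} | k. k < length (swb \<gamma>)}"

definition loop_edges :: "dyck_loop \<Rightarrow> point set set" where
  "loop_edges \<gamma> = neb_edges \<gamma> \<union> swb_edges \<gamma>"

(* The horizontal line through the centre of an enclosed box crosses the southwest boundary to
   the left of the box and the northeast boundary to its right; each boundary crosses the strip
   between the rows i and i+1 at most once. *)
definition enclosed_boxes :: "dyck_loop \<Rightarrow> (nat \<times> nat) set" where
  "enclosed_boxes \<gamma> =
     {(i, j). (\<exists>c\<le>j. {(i, c), (i + 1, c)} \<in> swb_edges \<gamma>) \<and>
              (\<exists>c>j. {(i, c), (i + 1, c)} \<in> neb_edges \<gamma>)}"

definition loop_inv :: "nat \<Rightarrow> dyck_loop \<Rightarrow> int" where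
  "loop_inv n \<gamma> = island_inv n (\<lambda>i j. if (i, j) \<in> enclosed_boxes \<gamma> then 1 else 0)"

(* The last two conditions fix which decomposition is meant. Distinct loops may be nested and may
   touch, but they do not cross: a crossing at an off-diagonal point would make two loops overlap
   without being nested. And where one loop could end and another begin at a common diagonal
   point, the two form a single loop. *)
definition boundary_loops :: "nat \<Rightarrow> (nat \<Rightarrow> nat \<Rightarrow> int) \<Rightarrow> dyck_loop set \<Rightarrow> bool" where
  "boundary_loops n \<delta> \<Gamma> \<longleftrightarrow>
     finite \<Gamma> \<and>
     (\<forall>\<gamma>\<in>\<Gamma>. is_loop n \<gamma>) \<and>
     (\<Union>\<gamma>\<in>\<Gamma>. loop_edges \<gamma>) = boundary_edges \<delta> \<and>
     (\<forall>\<gamma>\<in>\<Gamma>. \<forall>\<gamma>'\<in>\<Gamma>. \<gamma> \<noteq> \<gamma>' \<longrightarrow> loop_edges \<gamma> \<inter> loop_edges \<gamma>' = {}) \<and>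
     (\<forall>i j. \<delta> i j = int (card {\<gamma> \<in> \<Gamma>. (i, j) \<in> enclosed_boxes \<gamma>})) \<and>
     (\<forall>\<gamma>\<in>\<Gamma>. \<forall>\<gamma>'\<in>\<Gamma>. enclosed_boxes \<gamma> \<subseteq> enclosed_boxes \<gamma>' \<or>
        enclosed_boxes \<gamma>' \<subseteq> enclosed_boxes \<gamma> \<or> enclosed_boxes \<gamma> \<inter> enclosed_boxes \<gamma>' = {}) \<and>
     (\<forall>\<gamma>\<in>\<Gamma>. \<forall>\<gamma>'\<in>\<Gamma>. stop \<gamma> \<noteq> start \<gamma>')"

definition off_diagonal_osculations :: "dyck_loop set \<Rightarrow> point set" where
  "off_diagonal_osculations \<Gamma> =
     {(i, j). i \<noteq> j \<and>
        (\<exists>\<gamma>\<in>\<Gamma>. \<exists>\<gamma>'\<in>\<Gamma>. \<gamma> \<noteq> \<gamma>' \<and> (i, j) \<in> loop_points \<gamma> \<and> (i, j) \<in> loop_points \<gamma>')}"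

end

theory Submission
  imports Defs
begin

text \<open>The island \<open>f\<close> of \<open>A\<close> is \<open>min i j\<close> minus the corner sums of \<open>A\<close>, and the inversion number is
  the sum over all positions of a row partial sum times a column partial sum. Hence
  \<open>inv(A) = L(f) + B(f, f)\<close> with \<open>L\<close> linear and \<open>B\<close> bilinear. The island is the sum of the indicators
  of the boxes enclosed by the loops, so the defect in the additivity of \<open>inv\<close> is the sum of
  \<open>B(s, t) + B(t, s)\<close> over the pairs of loops. Summation by parts writes
  \<open>B(s, t) + B(t, s)\<close> as minus the sum over all lattice points \<open>v\<close> of \<open>D\<^sub>v(s) (t\<^sub>N\<^sub>E + t\<^sub>S\<^sub>W)\<close>, where \<open>D\<close> is the mixed
  difference around \<open>v\<close> and NE, SW are the two boxes at \<open>v\<close> on the antidiagonal. If \<open>s\<close> lies inside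
  \<open>t\<close>, the four boxes at \<open>v\<close> show that this product is \<open>2 D\<^sub>v(s)\<close>, increased by 1 when \<open>v\<close> is an
  off-diagonal osculation of \<open>s\<close> and \<open>t\<close>; and the sum of all \<open>D\<^sub>v(s)\<close> is 0. If \<open>s\<close> and \<open>t\<close> enclose
  no common box, the product always vanishes, and there is no off-diagonal osculation.
  Finally, only two edge-disjoint loops fit through one lattice point.\<close>

subsection \<open>Matrices determined by their islands\<close>

definition corner :: "int mat \<Rightarrow> nat \<Rightarrow> nat \<Rightarrow> int" where
  "corner A i j = (\<Sum>i'<i. \<Sum>j'<j. A $$ (i', j'))"

definition zero_outside :: "nat \<Rightarrow> (nat \<Rightarrow> nat \<Rightarrow> int) \<Rightarrow> bool" where
  "zero_outside n f \<longleftrightarrow> (\<forall>i j. f i j \<noteq> 0 \<longrightarrow> i \<in> {1..<n} \<and> j \<in> {1..<n})"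

lemma zero_outsideD:
  assumes "zero_outside n f"
  shows "f 0 j = 0" "f i 0 = 0" "f n j = 0" "f i n = 0"
  using assms unfolding zero_outside_def by force+

lemma corner_one:
  assumes "i \<le> n" "j \<le> n"
  shows "corner (1\<^sub>m n) i j = int (min i j)"
proof -
  have "corner (1\<^sub>m n) i j = (\<Sum>i'<i. \<Sum>j'<j. if i' = j' then 1 else 0)"
    unfolding corner_def using assms by (intro sum.cong refl) auto
  also have "\<dots> = (\<Sum>i'<i. if i' < j then 1 else 0)"
    by (intro sum.cong refl) simp
  also have "\<dots> = int (card ({..<i} \<inter> {..<j}))"
    by (simp add: sum.If_cases lessThan_def)
  also have "{..<i} \<inter> {..<j} = {..<min i j}" by auto
  finally show ?thesis by simp
qed

text \<open>When \<open>i\<close> or \<open>j\<close> is \<open>0\<close> or \<open>n\<close>, the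
  zero extension of the island is the right value: empty sums are 0, and full rows and columns sum
  to 1.\<close>

lemma corner_eq_island:
  assumes A: "asm n A" and "i \<le> n" "j \<le> n"
  shows "corner A i j = int (min i j) - dyck_island n A i j"
proof -
  have row: "(\<Sum>j<n. A $$ (i, j)) = 1" if "i < n" for i
    using A that by (auto simp: asm_def)
  have col: "(\<Sum>i<n. A $$ (i, j)) = 1" if "j < n" for j
    using A that by (auto simp: asm_def)
  consider "i = 0 \<or> j = 0" | "i = n" | "j = n" | "i \<in> {1..<n}" "j \<in> {1..<n}"
    using assms by force
  then show ?thesis
  proof cases
    case 1
    then show ?thesis by (auto simp: corner_def dyck_island_def)
  next
    case 2
    have "corner A n j = (\<Sum>j'<j. \<Sum>i'<n. A $$ (i', j'))"
      unfolding corner_def by (rule sum.swap)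
    also have "\<dots> = (\<Sum>j'<j. 1)" using assms by (intro sum.cong refl col) auto
    finally show ?thesis using 2 assms by (simp add: dyck_island_def)
  next
    case 3
    have "corner A i n = (\<Sum>i'<i. 1)"
      unfolding corner_def using assms by (intro sum.cong refl row) auto
    then show ?thesis using 3 assms by (simp add: dyck_island_def)
  next
    case 4
    have "height A i j - height (1\<^sub>m n) i j = 2 * (int (min i j) - corner A i j)"
      using corner_one[OF assms(2,3)] by (simp add: height_def corner_def)
    then show ?thesis using 4 by (simp add: dyck_island_def)
  qed
qed

lemma corner_diff_row: "corner A (Suc i) j - corner A i j = (\<Sum>l<j. A $$ (i, l))"
  by (simp add: corner_def)

lemma corner_diff_col: "corner A i (Suc j) - corner A i j = (\<Sum>l<i. A $$ (l, j))"
  by (simp add: corner_def sum.distrib)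

lemma entry_eq_corner:
  "A $$ (i, j) = corner A (Suc i) (Suc j) - corner A i (Suc j) - corner A (Suc i) j + corner A i j"
  by (simp add: corner_def)

text \<open>These increments are the row and column partial sums of the identity matrix; the
  differences of the island measure the deviation from them.\<close>

lemma int_min_Suc:
  "int (min (Suc i) j) = int (min i j) + of_bool (i < j)"
  "int (min i (Suc j)) = int (min i j) + of_bool (j < i)"
  by (auto simp: min_def not_less_eq_eq)

text \<open>Entries are second differences of corner sums, and the island determines the corner
  sums. This gives the uniqueness behind \<open>asm_of_island\<close>.\<close>

lemma asm_eqI:
  assumes "asm n A" "asm n B"
    and "\<And>i j. i \<in> {1..<n} \<Longrightarrow> j \<in> {1..<n} \<Longrightarrow> dyck_island n A i j = dyck_island n B i j"
  shows "A = B"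
proof -
  have "dyck_island n A i j = dyck_island n B i j" for i j
    using assms(3)[of i j] by (cases "i \<in> {1..<n} \<and> j \<in> {1..<n}") (auto simp: dyck_island_def)
  then have C: "corner A i j = corner B i j" if "i \<le> n" "j \<le> n" for i j
    using corner_eq_island assms(1,2) that by simp
  have "A $$ (i, j) = B $$ (i, j)" if "i < n" "j < n" for i j
    using C that by (simp add: entry_eq_corner)
  moreover have "A \<in> carrier_mat n n" "B \<in> carrier_mat n n" using assms by (auto simp: asm_def)
  ultimately show ?thesis by (intro eq_matI) auto
qed

lemma asm_of_island_eq:
  assumes "asm n A" "\<And>i j. i \<in> {1..<n} \<Longrightarrow> j \<in> {1..<n} \<Longrightarrow> dyck_island n A i j = f i j"
  shows "asm_of_island n f = A"
  unfolding asm_of_island_def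
  by (rule the_equality) (use assms in \<open>auto intro!: asm_eqI[where n = n]\<close>)

text \<open>Consecutive nonzero entries are successive jumps of the partial sum; to stay within
  \<open>{0, 1}\<close> the jumps must alternate between 1 and -1.\<close>

lemma alternating_if_partial_sums:
  fixes x :: "nat \<Rightarrow> int"
  assumes p: "\<And>j. j \<le> n \<Longrightarrow> (\<Sum>l<j. x l) \<in> {0, 1}"
    and "j' < j" "j < n" "x j' \<noteq> 0" "x j \<noteq> 0" and zero: "\<forall>l\<in>{j'<..<j}. x l = 0"
  shows "x j = - x j'"
proof -
  have "{..<j} = {..<Suc j'} \<union> {j'<..<j}" using assms(2) by auto
  moreover have "{..<Suc j'} \<inter> {j'<..<j} = {}" by auto
  ultimately have "(\<Sum>l<j. x l) = (\<Sum>l<Suc j'. x l) + (\<Sum>l\<in>{j'<..<j}. x l)"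
    by (simp add: sum.union_disjoint)
  moreover have "(\<Sum>l\<in>{j'<..<j}. x l) = 0" using zero by (intro sum.neutral) auto
  ultimately have "(\<Sum>l<j. x l) = (\<Sum>l<j'. x l) + x j'" by simp
  then show ?thesis
    using p[of j] p[of j'] p[of "Suc j"] assms(2-5) by auto
qed

text \<open>On corner sums this is the matrix entry at \<open>(i, j)\<close>; on islands it is
  centred at the lattice point \<open>(i + 1, j + 1)\<close>.\<close>

definition mixed_diff :: "(nat \<Rightarrow> nat \<Rightarrow> int) \<Rightarrow> nat \<Rightarrow> nat \<Rightarrow> int" where
  "mixed_diff f i j = f (Suc i) (Suc j) - f i (Suc j) - f (Suc i) j + f i j"

lemma sum_mixed_diff:
  "(\<Sum>i'<i. \<Sum>j'<j. mixed_diff f i' j') = f i j - f 0 j - f i 0 + f 0 0"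
proof -
  have "(\<Sum>j'<j. mixed_diff f i' j') = (f (Suc i') j - f (Suc i') 0) - (f i' j - f i' 0)" for i'
    by (induction j) (auto simp: mixed_diff_def)
  then show ?thesis by (induction i) auto
qed

text \<open>The conditions \<open>row\<close> and \<open>col\<close> put all partial sums of the
  prospective matrix into \<open>{0, 1}\<close>, which bounds the entries and makes the signs
  alternate. Vanishing at the border makes the full sums 1.\<close>

lemma ex_asm_of_island:
  assumes f: "zero_outside n f"
    and row: "\<And>i j. i < n \<Longrightarrow> j \<le> n \<Longrightarrow> of_bool (i < j) - (f (Suc i) j - f i j) \<in> {0, 1}"
    and col: "\<And>i j. i \<le> n \<Longrightarrow> j < n \<Longrightarrow> of_bool (j < i) - (f i (Suc j) - f i j) \<in> {0, 1}"
  shows "\<exists>A. asm n A \<and> dyck_island n A = f"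
proof -
  note zero = zero_outsideD[OF f]
  \<comment> \<open>The prospective corner sums: those of the identity matrix minus the
    island.\<close>
  define g where "g i j = int (min i j) - f i j" for i j
  define A where "A = mat n n (\<lambda>(i, j). mixed_diff g i j)"
  have C: "corner A i j = g i j" if "i \<le> n" "j \<le> n" for i j
  proof -
    have "corner A i j = (\<Sum>i'<i. \<Sum>j'<j. mixed_diff g i' j')"
      unfolding corner_def A_def using that by (intro sum.cong refl) auto
    then show ?thesis by (simp add: sum_mixed_diff g_def zero)
  qed
  have R: "(\<Sum>l<j. A $$ (i, l)) = of_bool (i < j) - (f (Suc i) j - f i j)" if "i < n" "j \<le> n" for i j
    using corner_diff_row[of A i j] C[of i j] C[of "Suc i" j] that by (simp add: g_def int_min_Suc)
  have K: "(\<Sum>l<i. A $$ (l, j)) = of_bool (j < i) - (f i (Suc j) - f i j)" if "i \<le> n" "j < n" for i j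
    using corner_diff_col[of A i j] C[of i j] C[of i "Suc j"] that by (simp add: g_def int_min_Suc)
  have entry: "A $$ (i, j) \<in> {0, 1, -1}" if "i < n" "j < n" for i j
    using R[of i j] R[of i "Suc j"] row[of i j] row[of i "Suc j"] that by auto
  have "asm n A"
    unfolding asm_def
  proof (intro conjI allI impI ballI; (elim conjE)?)
    show "A \<in> carrier_mat n n" by (simp add: A_def)
    show "A $$ (i, j) \<in> {0, 1, -1}" if "i < n" "j < n" for i j
      using entry that .
    show "(\<Sum>j<n. A $$ (i, j)) = 1" if "i < n" for i using R[of i n] that by (simp add: zero)
    show "(\<Sum>i<n. A $$ (i, j)) = 1" if "j < n" for j using K[of n j] that by (simp add: zero)
    show "A $$ (i, j) = - A $$ (i, j')" if "i < n" "j < n" "j' < j" "A $$ (i, j') \<noteq> 0"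
      "A $$ (i, j) \<noteq> 0" "\<forall>l\<in>{j'<..<j}. A $$ (i, l) = 0" for i j j'
      using alternating_if_partial_sums[of n "\<lambda>l. A $$ (i, l)" j' j] that R row by simp
    show "A $$ (i, j) = - A $$ (i', j)" if "j < n" "i < n" "i' < i" "A $$ (i', j) \<noteq> 0"
      "A $$ (i, j) \<noteq> 0" "\<forall>l\<in>{i'<..<i}. A $$ (l, j) = 0" for i j i'
      using alternating_if_partial_sums[of n "\<lambda>l. A $$ (l, j)" i' i] that K col by simp
  qed
  moreover have "dyck_island n A i j = f i j" for i j
  proof (cases "i \<in> {1..<n} \<and> j \<in> {1..<n}")
    case True
    then show ?thesis
      using corner_eq_island[OF \<open>asm n A\<close>, of i j] C[of i j] by (auto simp: g_def)
  next
    case False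
    then show ?thesis using f unfolding zero_outside_def dyck_island_def by auto
  qed
  ultimately show ?thesis by blast
qed

subsection \<open>The inversion number as a quadratic function of the island\<close>

text \<open>The cross terms between identity and island in the product of row and column partial
  sums. No constant term arises, since \<open>i < j\<close> and \<open>j < i\<close> exclude each
  other.\<close>

definition inv_linear :: "nat \<Rightarrow> (nat \<Rightarrow> nat \<Rightarrow> int) \<Rightarrow> int" where
  "inv_linear n f = (\<Sum>i<n. \<Sum>j<n.
     - of_bool (i < j) * (f i (Suc j) - f i j) - of_bool (j < i) * (f (Suc i) j - f i j))"

definition inv_bilinear :: "nat \<Rightarrow> (nat \<Rightarrow> nat \<Rightarrow> int) \<Rightarrow> (nat \<Rightarrow> nat \<Rightarrow> int) \<Rightarrow> int" where
  "inv_bilinear n f g = (\<Sum>i<n. \<Sum>j<n. (f (Suc i) j - f i j) * (g i (Suc j) - g i j))"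

text \<open>Fix the row \<open>i\<close> of the lower entry of an inversion and the column
  \<open>j'\<close> of the upper one. The remaining sums factor into the partial sum of row
  \<open>i\<close> left of \<open>j'\<close> and that of column \<open>j'\<close> above
  \<open>i\<close>.\<close>

lemma asm_inv_eq:
  assumes A: "asm n A"
  shows "asm_inv n A =
    inv_linear n (dyck_island n A) + inv_bilinear n (dyck_island n A) (dyck_island n A)"
proof -
  let ?f = "dyck_island n A"
  note C = corner_eq_island[OF A]
  have R: "(\<Sum>l<j. A $$ (i, l)) = of_bool (i < j) - (?f (Suc i) j - ?f i j)" if "i < n" "j \<le> n" for i j
    using corner_diff_row[of A i j] C[of i j] C[of "Suc i" j] that by (simp add: int_min_Suc)
  have K: "(\<Sum>l<i. A $$ (l, j)) = of_bool (j < i) - (?f i (Suc j) - ?f i j)" if "i \<le> n" "j < n" for i j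
    using corner_diff_col[of A i j] C[of i j] C[of i "Suc j"] that by (simp add: int_min_Suc)
  have "asm_inv n A =
    (\<Sum>i<n. \<Sum>j'<n. \<Sum>i'<i. \<Sum>j<j'. A $$ (i, j) * A $$ (i', j'))"
    unfolding asm_inv_def by (intro sum.cong refl sum.swap)
  also have "\<dots> = (\<Sum>i<n. \<Sum>j'<n. (\<Sum>j<j'. A $$ (i, j)) * (\<Sum>i'<i. A $$ (i', j')))"
    unfolding sum_product by (intro sum.cong refl sum.swap)
  also have "\<dots> = (\<Sum>i<n. \<Sum>j<n. (of_bool (i < j) - (?f (Suc i) j - ?f i j)) *
      (of_bool (j < i) - (?f i (Suc j) - ?f i j)))"
    by (intro sum.cong refl) (use R K in auto)
  also have "\<dots> = (\<Sum>i<n. \<Sum>j<n.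
     (- of_bool (i < j) * (?f i (Suc j) - ?f i j) - of_bool (j < i) * (?f (Suc i) j - ?f i j)) +
     (?f (Suc i) j - ?f i j) * (?f i (Suc j) - ?f i j))"
    by (intro sum.cong refl) (auto simp: algebra_simps)
  finally show ?thesis by (simp add: inv_linear_def inv_bilinear_def sum.distrib)
qed

lemma island_inv_eq:
  assumes "asm n A" "dyck_island n A = f"
  shows "island_inv n f = inv_linear n f + inv_bilinear n f f"
  using asm_of_island_eq[of n A f] asm_inv_eq[of n A] assms by (simp add: island_inv_def)

lemma inv_linear_sum: "inv_linear n (\<lambda>i j. \<Sum>s\<in>I. f s i j) = (\<Sum>s\<in>I. inv_linear n (f s))"
proof -
  have "inv_linear n (\<lambda>i j. \<Sum>s\<in>I. f s i j) = (\<Sum>i<n. \<Sum>j<n. \<Sum>s\<in>I.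
     - of_bool (i < j) * (f s i (Suc j) - f s i j) - of_bool (j < i) * (f s (Suc i) j - f s i j))"
    unfolding inv_linear_def
    by (simp add: sum_subtractf sum_distrib_left sum_negf right_diff_distrib)
  then show ?thesis
    by (simp add: inv_linear_def sum.swap[of _ I "{..<n}"] del: mult_minus_left)
qed

lemma inv_bilinear_sum:
  "inv_bilinear n (\<lambda>i j. \<Sum>s\<in>I. f s i j) (\<lambda>i j. \<Sum>s\<in>I. g s i j) =
    (\<Sum>s\<in>I. \<Sum>t\<in>I. inv_bilinear n (f s) (g t))"
proof -
  have "inv_bilinear n (\<lambda>i j. \<Sum>s\<in>I. f s i j) (\<lambda>i j. \<Sum>s\<in>I. g s i j) =
    (\<Sum>i<n. \<Sum>j<n. \<Sum>s\<in>I. \<Sum>t\<in>I. (f s (Suc i) j - f s i j) * (g t i (Suc j) - g t i j))"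
    unfolding inv_bilinear_def by (simp add: sum_subtractf[symmetric] sum_product)
  then show ?thesis
    by (simp add: inv_bilinear_def sum.swap[of _ I "{..<n}"])
qed

section \<open>Summation by parts\<close>

lemma sum_by_parts:
  fixes F g :: "nat \<Rightarrow> int"
  shows "(\<Sum>j<n. F j * (g (Suc j) - g j)) =
    F n * g n - F 0 * g 0 - (\<Sum>j<n. (F (Suc j) - F j) * g (Suc j))"
  by (induction n) (auto simp: algebra_simps)

text \<open>The first term is summed by parts along rows, the second along columns. Both differences
  then fall on \<open>f\<close>, and the index shift leaves the NE and SW values of
  \<open>g\<close>. The border terms vanish with \<open>g\<close>.\<close>

lemma inv_bilinear_symmetrized:
  assumes "zero_outside n f" "zero_outside n g"
  shows "inv_bilinear n f g + inv_bilinear n g f =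
    - (\<Sum>i<n. \<Sum>j<n. mixed_diff f i j * (g i (Suc j) + g (Suc i) j))"
proof -
  note zf = zero_outsideD[OF assms(1)] and zg = zero_outsideD[OF assms(2)]
  have "inv_bilinear n f g = (\<Sum>i<n. - (\<Sum>j<n. mixed_diff f i j * g i (Suc j)))"
    unfolding inv_bilinear_def
    by (subst sum_by_parts) (simp add: zg mixed_diff_def algebra_simps)
  moreover have "inv_bilinear n g f =
    (\<Sum>j<n. \<Sum>i<n. (f i (Suc j) - f i j) * (g (Suc i) j - g i j))"
    unfolding inv_bilinear_def by (subst sum.swap) (simp add: mult.commute)
  then have "inv_bilinear n g f = (\<Sum>j<n. - (\<Sum>i<n. mixed_diff f i j * g (Suc i) j))"
    by (subst (asm) sum_by_parts) (simp add: zg mixed_diff_def algebra_simps)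
  then have "inv_bilinear n g f = - (\<Sum>i<n. \<Sum>j<n. mixed_diff f i j * g (Suc i) j)"
    unfolding sum_negf by (subst sum.swap)
  ultimately show ?thesis by (simp add: sum_negf sum.distrib algebra_simps)
qed

subsection \<open>Sets of boxes\<close>

definition box_ind :: "(nat \<times> nat) set \<Rightarrow> nat \<Rightarrow> nat \<Rightarrow> int" where
  "box_ind S i j = (if (i, j) \<in> S then 1 else 0)"

text \<open>The trace of the Dyck condition on the enclosed boxes. Truncated subtraction is
  harmless, since the coordinate concerned is positive.\<close>

definition diag_convex :: "(nat \<times> nat) set \<Rightarrow> bool" where
  "diag_convex S \<longleftrightarrow> (\<forall>i j. (i, j) \<in> S \<longrightarrow>
     (i < j \<longrightarrow> (Suc i, j) \<in> S \<and> (i, j - 1) \<in> S) \<and> (j < i \<longrightarrow> (i, Suc j) \<in> S \<and> (i - 1, j) \<in> S))"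

definition edge_disjoint :: "(nat \<times> nat) set \<Rightarrow> (nat \<times> nat) set \<Rightarrow> bool" where
  "edge_disjoint S T \<longleftrightarrow> (\<forall>i j.
     (((i, j) \<in> S) = ((i, Suc j) \<in> S) \<or> ((i, j) \<in> T) = ((i, Suc j) \<in> T)) \<and>
     (((i, j) \<in> S) = ((Suc i, j) \<in> S) \<or> ((i, j) \<in> T) = ((Suc i, j) \<in> T)))"

text \<open>The lattice point concerned is \<open>(i + 1, j + 1)\<close>; it is surrounded by the four boxes below.\<close>

definition on_border :: "(nat \<times> nat) set \<Rightarrow> nat \<Rightarrow> nat \<Rightarrow> bool" where
  "on_border S i j \<longleftrightarrow> \<not> {(i, j), (i, Suc j), (Suc i, j), (Suc i, Suc j)} \<subseteq> S \<and>
     {(i, j), (i, Suc j), (Suc i, j), (Suc i, Suc j)} \<inter> S \<noteq> {}"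

text \<open>A shape records membership of the four boxes around a lattice point in the order
  NW, NE, SW, SE.\<close>

definition above_shapes :: "(bool \<times> bool \<times> bool \<times> bool) set" where
  "above_shapes =
     {(False, False, False, False), (False, False, True, False), (True, False, True, False),
      (False, False, True, True), (True, False, True, True), (True, True, True, True)}"

definition below_shapes :: "(bool \<times> bool \<times> bool \<times> bool) set" where
  "below_shapes = (\<lambda>(nw, ne, sw, se). (nw, sw, ne, se)) ` above_shapes"

text \<open>The shape with NW and SE alone is a pinch, where the two boundaries of one loop meet
  between its endpoints.\<close>

definition diagonal_shapes :: "(bool \<times> bool \<times> bool \<times> bool) set" where
  "diagonal_shapes =
     {(False, False, False, False), (True, False, False, False), (False, False, False, True),
      (True, False, False, True), (True, True, False, True), (True, False, True, True),
      (True, True, True, True)}"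

definition shape :: "(nat \<times> nat) set \<Rightarrow> nat \<Rightarrow> nat \<Rightarrow> bool \<times> bool \<times> bool \<times> bool" where
  "shape S i j = ((i, j) \<in> S, (i, Suc j) \<in> S, (Suc i, j) \<in> S, (Suc i, Suc j) \<in> S)"

text \<open>Above the diagonal NE forces NW and SE, and either of these forces SW; below it NE and
  SW exchange roles. On the diagonal NE and SW each force NW and SE.\<close>

lemma diag_convex_shapes:
  assumes S: "diag_convex S"
  shows "i < j \<Longrightarrow> shape S i j \<in> above_shapes"
    and "j < i \<Longrightarrow> shape S i j \<in> below_shapes"
    and "shape S i i \<in> diagonal_shapes"
proof -
  \<comment> \<open>NE lies strictly above the diagonal even if \<open>i = j\<close>, so this fact
    and its mirror image \<open>2\<close> also serve the diagonal points.\<close>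
  have 1: "(i, j) \<in> S \<and> (Suc i, Suc j) \<in> S" if "i \<le> j" "(i, Suc j) \<in> S" for i j
    using S that unfolding diag_convex_def by force
  have 2: "(i, j) \<in> S \<and> (Suc i, Suc j) \<in> S" if "j \<le> i" "(Suc i, j) \<in> S" for i j
    using S that unfolding diag_convex_def by force
  have 3: "(Suc i, j) \<in> S" if "i < j" "(i, j) \<in> S \<or> (Suc i, Suc j) \<in> S" for i j
    using S that unfolding diag_convex_def by force
  have 4: "(i, Suc j) \<in> S" if "j < i" "(i, j) \<in> S \<or> (Suc i, Suc j) \<in> S" for i j
    using S that unfolding diag_convex_def by force
  have above: "(a, b, c, d) \<in> above_shapes" if "b \<longrightarrow> a \<and> d" "a \<or> d \<longrightarrow> c" for a b c d
    using that by (cases a; cases b; cases c; cases d; simp add: above_shapes_def)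
  have below: "(a, b, c, d) \<in> below_shapes" if "c \<longrightarrow> a \<and> d" "a \<or> d \<longrightarrow> b" for a b c d
    using above[of c a d b] that unfolding below_shapes_def by force
  have diag: "(a, b, c, d) \<in> diagonal_shapes" if "b \<longrightarrow> a \<and> d" "c \<longrightarrow> a \<and> d" for a b c d
    using that by (cases a; cases b; cases c; cases d; simp add: diagonal_shapes_def)
  show "shape S i j \<in> above_shapes"
    if "i < j" unfolding shape_def using 1[where i = i and j = j] 3[where i = i and j = j] that by (intro above) simp_all
  show "shape S i j \<in> below_shapes"
    if "j < i" unfolding shape_def using 2[where i = i and j = j] 4[where i = i and j = j] that by (intro below) simp_all
  show "shape S i i \<in> diagonal_shapes"
    unfolding shape_def using 1[where i = i and j = i] 2[where i = i and j = i] by (intro diag) simp_all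
qed

lemma edge_disjoint_local:
  assumes "edge_disjoint S T"
  shows "((i, j) \<in> S) = ((i, Suc j) \<in> S) \<or> ((i, j) \<in> T) = ((i, Suc j) \<in> T)"
    and "((i, j) \<in> S) = ((Suc i, j) \<in> S) \<or> ((i, j) \<in> T) = ((Suc i, j) \<in> T)"
  using assms[unfolded edge_disjoint_def, THEN spec, THEN spec, of i j] by (rule conjunct1 conjunct2)+

lemma edge_disjoint_sym: "edge_disjoint S T \<Longrightarrow> edge_disjoint T S"
  by (subst edge_disjoint_def, intro allI conjI; subst disj_commute; rule edge_disjoint_local)

section \<open>Finite identities for the shapes of two sets at one point\<close>

fun mixed_diff_shape :: "bool \<times> bool \<times> bool \<times> bool \<Rightarrow> int" where
  "mixed_diff_shape (a, b, c, d) = of_bool d - of_bool b - of_bool c + of_bool a"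

fun antidiag_shape :: "bool \<times> bool \<times> bool \<times> bool \<Rightarrow> int" where
  "antidiag_shape (a, b, c, d) = of_bool b + of_bool c"

fun border_shape :: "bool \<times> bool \<times> bool \<times> bool \<Rightarrow> bool" where
  "border_shape (a, b, c, d) \<longleftrightarrow> \<not> (a \<and> b \<and> c \<and> d) \<and> (a \<or> b \<or> c \<or> d)"

fun edge_disjoint_shapes :: "bool \<times> bool \<times> bool \<times> bool \<Rightarrow> bool \<times> bool \<times> bool \<times> bool \<Rightarrow> bool" where
  "edge_disjoint_shapes (a, b, c, d) (a', b', c', d') \<longleftrightarrow>
     (a = b \<or> a' = b') \<and> (a = c \<or> a' = c') \<and> (c = d \<or> c' = d') \<and> (b = d \<or> b' = d')"

fun subset_shapes :: "bool \<times> bool \<times> bool \<times> bool \<Rightarrow> bool \<times> bool \<times> bool \<times> bool \<Rightarrow> bool" where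
  "subset_shapes (a, b, c, d) (a', b', c', d') \<longleftrightarrow> (a \<longrightarrow> a') \<and> (b \<longrightarrow> b') \<and> (c \<longrightarrow> c') \<and> (d \<longrightarrow> d')"

fun disjoint_shapes :: "bool \<times> bool \<times> bool \<times> bool \<Rightarrow> bool \<times> bool \<times> bool \<times> bool \<Rightarrow> bool" where
  "disjoint_shapes (a, b, c, d) (a', b', c', d') \<longleftrightarrow>
     \<not> (a \<and> a') \<and> \<not> (b \<and> b') \<and> \<not> (c \<and> c') \<and> \<not> (d \<and> d')"

lemma below_shapes_eq:
  "below_shapes =
     {(False, False, False, False), (False, True, False, False), (True, True, False, False),
      (False, True, False, True), (True, True, False, True), (True, True, True, True)}"
  by (simp add: below_shapes_def above_shapes_def)

text \<open>Above the diagonal every nonempty shape contains SW, so of two disjoint shapes one is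
  empty. For nested edge-disjoint shapes with \<open>s\<close> nonempty, \<open>t\<close> is full,
  with one exception: \<open>s\<close> is SW alone and \<open>t\<close> lacks only NE. That is the
  osculation, with mixed difference -1 and one antidiagonal box instead of two. Below the diagonal
  NE and SW are exchanged.\<close>

lemma off_diagonal_shape_identities:
  assumes "s \<in> above_shapes \<and> t \<in> above_shapes \<or> s \<in> below_shapes \<and> t \<in> below_shapes"
  shows "edge_disjoint_shapes s t \<Longrightarrow> subset_shapes s t \<Longrightarrow>
      mixed_diff_shape s * antidiag_shape t =
      2 * mixed_diff_shape s + of_bool (border_shape s \<and> border_shape t)"
    and "disjoint_shapes s t \<Longrightarrow>
      mixed_diff_shape s * antidiag_shape t = of_bool (border_shape s \<and> border_shape t)"
  using assms unfolding above_shapes_def below_shapes_eq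
  by (elim disjE conjE insertE emptyE; hypsubst; simp)+

text \<open>A nonempty \<open>s\<close> inside an edge-disjoint \<open>t\<close> forces
  \<open>t\<close> to be full, so no correction appears. In the disjoint case, if \<open>t\<close>
  contains NE or SW, then it contains NW and SE, which leaves \<open>s\<close> empty.\<close>

lemma diagonal_shape_identities:
  assumes "s \<in> diagonal_shapes" "t \<in> diagonal_shapes"
  shows "edge_disjoint_shapes s t \<Longrightarrow> subset_shapes s t \<Longrightarrow>
      mixed_diff_shape s * antidiag_shape t = 2 * mixed_diff_shape s"
    and "disjoint_shapes s t \<Longrightarrow> mixed_diff_shape s * antidiag_shape t = 0"
  using assms unfolding diagonal_shapes_def
  by (elim disjE conjE insertE emptyE; hypsubst; simp)+

lemma shape_conv:
  "mixed_diff (box_ind S) i j = mixed_diff_shape (shape S i j)"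
  "box_ind S i (Suc j) + box_ind S (Suc i) j = antidiag_shape (shape S i j)"
  "on_border S i j \<longleftrightarrow> border_shape (shape S i j)"
  by (simp_all add: mixed_diff_def box_ind_def shape_def on_border_def)

lemma edge_disjoint_shapes_shape:
  assumes "edge_disjoint S T"
  shows "edge_disjoint_shapes (shape S i j) (shape T i j)"
  unfolding shape_def edge_disjoint_shapes.simps by (intro conjI edge_disjoint_local assms)

lemma nested_local:
  assumes S: "diag_convex S" and T: "diag_convex T" and ST: "edge_disjoint S T" and "S \<subseteq> T"
  shows "mixed_diff (box_ind S) i j * (box_ind T i (Suc j) + box_ind T (Suc i) j) =
    2 * mixed_diff (box_ind S) i j + of_bool (i \<noteq> j \<and> on_border S i j \<and> on_border T i j)"
proof -
  have sub: "subset_shapes (shape S i j) (shape T i j)" using assms(4) by (auto simp: shape_def)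
  note ed = edge_disjoint_shapes_shape[OF ST, of i j]
  consider "i = j" | "i < j" | "j < i" by linarith
  then show ?thesis
  proof cases
    case 1
    then show ?thesis
      using diagonal_shape_identities(1)[OF diag_convex_shapes(3)[OF S] diag_convex_shapes(3)[OF T]] ed sub
      by (simp add: shape_conv)
  next
    case 2
    then have "shape S i j \<in> above_shapes \<and> shape T i j \<in> above_shapes"
      using diag_convex_shapes(1)[OF S] diag_convex_shapes(1)[OF T] by blast
    from off_diagonal_shape_identities(1)[OF disjI1[OF this] ed sub] 2 show ?thesis by (simp add: shape_conv)
  next
    case 3
    then have "shape S i j \<in> below_shapes \<and> shape T i j \<in> below_shapes"
      using diag_convex_shapes(2)[OF S] diag_convex_shapes(2)[OF T] by blast
    from off_diagonal_shape_identities(1)[OF disjI2[OF this] ed sub] 3 show ?thesis by (simp add: shape_conv)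
  qed
qed

lemma disjoint_local:
  assumes S: "diag_convex S" and T: "diag_convex T" and "S \<inter> T = {}"
  shows "mixed_diff (box_ind S) i j * (box_ind T i (Suc j) + box_ind T (Suc i) j) =
    of_bool (i \<noteq> j \<and> on_border S i j \<and> on_border T i j)"
proof -
  have dis: "disjoint_shapes (shape S i j) (shape T i j)" using assms(3) by (auto simp: shape_def)
  consider "i = j" | "i < j" | "j < i" by linarith
  then show ?thesis
  proof cases
    case 1
    then show ?thesis
      using diagonal_shape_identities(2)[OF diag_convex_shapes(3)[OF S] diag_convex_shapes(3)[OF T]] dis
      by (simp add: shape_conv)
  next
    case 2
    then have "shape S i j \<in> above_shapes \<and> shape T i j \<in> above_shapes"
      using diag_convex_shapes(1)[OF S] diag_convex_shapes(1)[OF T] by blast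
    from off_diagonal_shape_identities(2)[OF disjI1[OF this] dis] 2 show ?thesis by (simp add: shape_conv)
  next
    case 3
    then have "shape S i j \<in> below_shapes \<and> shape T i j \<in> below_shapes"
      using diag_convex_shapes(2)[OF S] diag_convex_shapes(2)[OF T] by blast
    from off_diagonal_shape_identities(2)[OF disjI2[OF this] dis] 3 show ?thesis by (simp add: shape_conv)
  qed
qed

text \<open>One formula serves all three cases: for nested sets the doubled mixed differences
  telescope away, and for disjoint sets the sum on the right is itself 0.\<close>

lemma inv_bilinear_pair:
  assumes S: "diag_convex S" "zero_outside n (box_ind S)"
    and T: "diag_convex T" "zero_outside n (box_ind T)"
    and ST: "edge_disjoint S T" "S \<subseteq> T \<or> T \<subseteq> S \<or> S \<inter> T = {}"
  shows "inv_bilinear n (box_ind S) (box_ind T) + inv_bilinear n (box_ind T) (box_ind S) =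
    - (\<Sum>i<n. \<Sum>j<n. of_bool (i \<noteq> j \<and> on_border S i j \<and> on_border T i j))"
proof -
  have nested: "inv_bilinear n (box_ind S) (box_ind T) + inv_bilinear n (box_ind T) (box_ind S) =
    - (\<Sum>i<n. \<Sum>j<n. of_bool (i \<noteq> j \<and> on_border S i j \<and> on_border T i j))"
    if S: "diag_convex S" "zero_outside n (box_ind S)"
      and T: "diag_convex T" "zero_outside n (box_ind T)"
      and ST: "edge_disjoint S T" "S \<subseteq> T" for S T
  proof -
    have "(\<Sum>i<n. \<Sum>j<n. mixed_diff (box_ind S) i j) = 0"
      by (simp add: sum_mixed_diff zero_outsideD[OF S(2)])
    then show ?thesis
      by (simp add: inv_bilinear_symmetrized[OF S(2) T(2)] nested_local[OF S(1) T(1) ST]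
        sum.distrib sum_distrib_left[symmetric])
  qed
  show ?thesis using ST(2)
  proof (elim disjE)
    assume "S \<subseteq> T"
    then show ?thesis using nested[OF S T ST(1)] by blast
  next
    assume "T \<subseteq> S"
    then show ?thesis using nested[OF T S edge_disjoint_sym[OF ST(1)]]
      by (simp add: add.commute conj_commute)
  next
    assume "S \<inter> T = {}"
    then show ?thesis
      by (simp add: inv_bilinear_symmetrized[OF S(2) T(2)] disjoint_local[OF S(1) T(1)])
  qed
qed

text \<open>Going once around a point on the border of \<open>S\<close>, one crosses at least two edges of \<open>S\<close>.\<close>

lemma at_most_two_borders:
  assumes "edge_disjoint S T" "edge_disjoint S R" "edge_disjoint T R"
    and "on_border S i j" "on_border T i j" "on_border R i j"
  shows False
proof -
  \<comment> \<open>These indicate whether the edges leaving the lattice point to the north, west,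
    south and east separate boxes of \<open>X\<close> from other boxes.\<close>
  define N W B E where
    "N X = (of_bool (((i, j) \<in> X) \<noteq> ((i, Suc j) \<in> X)) :: nat)" and
    "W X = (of_bool (((i, j) \<in> X) \<noteq> ((Suc i, j) \<in> X)) :: nat)" and
    "B X = (of_bool (((Suc i, j) \<in> X) \<noteq> ((Suc i, Suc j) \<in> X)) :: nat)" and
    "E X = (of_bool (((i, Suc j) \<in> X) \<noteq> ((Suc i, Suc j) \<in> X)) :: nat)"
    for X :: "(nat \<times> nat) set"
  note defs = N_def E_def W_def B_def
  have two: "N X + E X + W X + B X \<ge> (2 :: nat)" if "on_border X i j" for X
    using that unfolding on_border_def defs
    by (cases "(i, j) \<in> X"; cases "(i, Suc j) \<in> X"; cases "(Suc i, j) \<in> X";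
        cases "(Suc i, Suc j) \<in> X"; simp)
  have at_most_one: "of_bool P + of_bool Q \<le> (1 :: nat)" if "\<not> P \<or> \<not> Q" for P Q
    using that by auto
  have one: "N X + N Y \<le> 1" "E X + E Y \<le> 1" "W X + W Y \<le> 1" "B X + B Y \<le> 1"
    if "edge_disjoint X Y" for X Y
    unfolding defs not_not
    by (rule at_most_one, unfold not_not, rule edge_disjoint_local[OF that])+
  note ones = one[OF assms(1)] one[OF assms(2)] one[OF assms(3)]
  \<comment> \<open>Adding the three pairwise bounds gives at most 3 for twice this integer, hence
    at most 1. The four directions allow 4 edges in total, while three borders need 6.\<close>
  have "N S + N T + N R \<le> 1" using ones by linarith
  moreover have "E S + E T + E R \<le> 1" using ones by linarith
  moreover have "W S + W T + W R \<le> 1" using ones by linarith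
  moreover have "B S + B T + B R \<le> 1" using ones by linarith
  ultimately show False using two[OF assms(4)] two[OF assms(5)] two[OF assms(6)] by linarith
qed

text \<open>Membership can only be gained on the way to the diagonal and only be lost on the way
  from it, so the differences have the sign that keeps the partial sums in \<open>{0, 1}\<close>.
  This existence gives meaning to the description in \<open>loop_inv\<close>.\<close>

lemma ex_asm_box_ind:
  assumes S: "diag_convex S" "zero_outside n (box_ind S)"
  shows "\<exists>A. asm n A \<and> dyck_island n A = box_ind S"
proof (rule ex_asm_of_island[OF S(2)])
  have "(i, j) \<in> S \<Longrightarrow> i < j \<Longrightarrow> (Suc i, j) \<in> S" "(Suc i, j) \<in> S \<Longrightarrow> j \<le> i \<Longrightarrow> (i, j) \<in> S"
    "(i, j) \<in> S \<Longrightarrow> j < i \<Longrightarrow> (i, Suc j) \<in> S" "(i, Suc j) \<in> S \<Longrightarrow> i \<le> j \<Longrightarrow> (i, j) \<in> S" for i j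
    using S(1) unfolding diag_convex_def by force+
  note steps = this[of i j for i j]
  show "of_bool (i < j) - (box_ind S (Suc i) j - box_ind S i j) \<in> {0, 1}" for i j
    using steps(1,2)[of i j] by (cases "i < j") (auto simp: box_ind_def)
  show "of_bool (j < i) - (box_ind S i (Suc j) - box_ind S i j) \<in> {0, 1}" for i j
    using steps(3,4)[of i j] by (cases "j < i") (auto simp: box_ind_def)
qed

subsection \<open>Loops\<close>

definition downs :: "step list \<Rightarrow> nat \<Rightarrow> nat" where
  "downs w k = count_list (take k w) D"

text \<open>A Dyck word seen through its number of steps D: after \<open>k\<close> steps there are
  \<open>k - d k\<close> steps U, so \<open>2 * d k \<le> k\<close> is the ballot condition.\<close>

definition dyck_path :: "nat \<Rightarrow> (nat \<Rightarrow> nat) \<Rightarrow> bool" where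
  "dyck_path m d \<longleftrightarrow> d 0 = 0 \<and> d (2 * m) = m \<and>
     (\<forall>k<2 * m. d (Suc k) = d k \<or> d (Suc k) = Suc (d k)) \<and> (\<forall>k\<le>2 * m. 2 * d k \<le> k)"

lemma count_U_plus_count_D: "count_list w U + count_list w D = length w"
proof (induction w)
  case (Cons x w)
  then show ?case by (cases x) auto
qed simp

lemma dyck_word_length: "dyck_word m w \<Longrightarrow> length w = 2 * m"
  using count_U_plus_count_D[of w] by (auto simp: dyck_word_def)

lemma count_take_U:
  assumes "dyck_word m w" "k \<le> 2 * m"
  shows "count_list (take k w) U = k - downs w k"
  using count_U_plus_count_D[of "take k w"] dyck_word_length[OF assms(1)] assms(2)
  by (simp add: downs_def)

lemma dyck_path_downs:
  assumes "dyck_word m w"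
  shows "dyck_path m (downs w)"
  unfolding dyck_path_def
proof (intro conjI allI impI)
  note len = dyck_word_length[OF assms]
  show "downs w 0 = 0" by (simp add: downs_def)
  show "downs w (2 * m) = m" using assms len by (simp add: downs_def dyck_word_def)
  show "downs w (Suc k) = downs w k \<or> downs w (Suc k) = Suc (downs w k)" if "k < 2 * m" for k
    using that len by (simp add: downs_def take_Suc_conv_app_nth)
  show "2 * downs w k \<le> k" if "k \<le> 2 * m" for k
  proof -
    have "downs w k \<le> count_list (take k w) U"
      using assms len that unfolding dyck_word_def downs_def by simp
    then show ?thesis
      using count_U_plus_count_D[of "take k w"] len that by (simp add: downs_def)
  qed
qed

lemma dyck_path_step:
  assumes "dyck_path m d" "k < 2 * m"
  shows "d (Suc k) = d k \<or> d (Suc k) = Suc (d k)"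
  using assms unfolding dyck_path_def by blast

lemma dyck_path_mono:
  assumes "dyck_path m d" "k \<le> l" "l \<le> 2 * m"
  shows "d k \<le> d l"
  using assms(2,3)
proof (induction l rule: dec_induct)
  case (step l)
  then show ?case using dyck_path_step[OF assms(1), of l] by force
qed simp

text \<open>A discrete intermediate value theorem: \<open>d\<close> climbs by at most 1, so it
  leaves level \<open>x\<close> by a step D.\<close>

lemma dyck_path_crossing:
  assumes "dyck_path m d" "k \<le> l" "l \<le> 2 * m" "d k \<le> x" "x < d l"
  obtains p where "k \<le> p" "p < l" "d p = x" "d (Suc p) = Suc x"
proof -
  have "\<exists>p. k \<le> p \<and> p < l \<and> d p = x \<and> d (Suc p) = Suc x"
    using assms(2,3,5)
  proof (induction l rule: dec_induct)
    case base
    then show ?case using assms(4) by simp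
  next
    case (step l)
    show ?case
    proof (cases "x < d l")
      case True
      then show ?thesis using step by (meson Suc_leD less_SucI)
    next
      case False
      then show ?thesis using dyck_path_step[OF assms(1), of l] step by (intro exI[of _ l]) force
    qed
  qed
  then show ?thesis using that by blast
qed

section \<open>The region between two Dyck paths\<close>

text \<open>The \<open>k\<close>-th vertices of both boundaries lie on the antidiagonal of coordinate sum \<open>2 a + k\<close>.
  So do two corners of the box \<open>(i, j)\<close> if \<open>i + j + 1 = 2 a + k\<close>, and the box is enclosed if and only
  if these corners lie between the two vertices. Here \<open>f\<close> and \<open>g\<close> count the steps D in the words of
  the northeast and the southwest boundary.\<close>

definition region :: "nat \<Rightarrow> nat \<Rightarrow> (nat \<Rightarrow> nat) \<Rightarrow> (nat \<Rightarrow> nat) \<Rightarrow> (nat \<times> nat) set" where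
  "region a m f g = {(i, j). \<exists>k. 0 < k \<and> k < 2 * m \<and> Suc (i + j) = 2 * a + k \<and>
     a + f k \<le> i \<and> a + g k \<le> j}"

lemma region_iff:
  assumes "Suc (i + j) = 2 * a + k"
  shows "(i, j) \<in> region a m f g \<longleftrightarrow> 0 < k \<and> k < 2 * m \<and> a + f k \<le> i \<and> a + g k \<le> j"
  using assms unfolding region_def by auto

lemma region_swap: "(i, j) \<in> region a m f g \<longleftrightarrow> (j, i) \<in> region a m g f"
  unfolding region_def by (auto simp: add.commute)

lemma dyck_path_bound: "dyck_path m d \<Longrightarrow> k \<le> 2 * m \<Longrightarrow> 2 * d k \<le> k"
  by (auto simp: dyck_path_def)

text \<open>The ballot condition at the odd index \<open>k\<close> excludes \<open>d k = m\<close>,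
  so the last step is D.\<close>

lemma dyck_path_last:
  assumes "dyck_path m d" "Suc k = 2 * m"
  shows "Suc (d k) = m" "d (Suc k) = m"
proof -
  show "d (Suc k) = m" using assms by (auto simp: dyck_path_def)
  then show "Suc (d k) = m"
    using dyck_path_step[OF assms(1), of k] dyck_path_bound[OF assms(1), of k] assms(2) by force
qed

text \<open>The new box lies on a neighbouring antidiagonal. The northeast inequality survives
  because \<open>f\<close> is monotone with steps of at most 1; the southwest one holds because that
  boundary stays on the other side of the diagonal.\<close>

lemma region_toward_diagonal:
  assumes f: "dyck_path m f" and g: "dyck_path m g"
    and ij: "(i, j) \<in> region a m f g" "i < j"
  shows "(Suc i, j) \<in> region a m f g" "(i, j - 1) \<in> region a m f g"
proof -
  obtain k where k: "0 < k" "k < 2 * m" "Suc (i + j) = 2 * a + k" "a + f k \<le> i" "a + g k \<le> j"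
    using ij(1) by (auto simp: region_def)
  \<comment> \<open>On the last antidiagonal the region has only a diagonal box, excluded by
    \<open>i < j\<close>; the same holds for the first one, treated below.\<close>
  have "Suc k \<noteq> 2 * m"
    using dyck_path_last(1)[OF f, of k] dyck_path_last(1)[OF g, of k] k ij(2) by force
  moreover have "f (Suc k) \<le> Suc (f k)" using dyck_path_step[OF f k(2)] by force
  moreover have "2 * g (Suc k) \<le> Suc k" using dyck_path_bound[OF g, of "Suc k"] k by simp
  ultimately show "(Suc i, j) \<in> region a m f g"
    using k ij(2) by (subst region_iff[where k = "Suc k"]) auto
  obtain l where l: "k = Suc l" using k by (cases k) auto
  have "f l \<le> f k" using dyck_path_mono[OF f, of l k] k l by simp
  moreover have "2 * g l \<le> l" using dyck_path_bound[OF g, of l] k l by simp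
  moreover have "l \<noteq> 0"
    using dyck_path_bound[OF g, of k] dyck_path_bound[OF f, of k] k l ij(2) by auto
  ultimately show "(i, j - 1) \<in> region a m f g"
    using k l ij(2) by (subst region_iff[where k = l]) auto
qed

lemma diag_convex_region:
  assumes "dyck_path m f" "dyck_path m g"
  shows "diag_convex (region a m f g)"
  unfolding diag_convex_def
  using region_toward_diagonal[OF assms] region_toward_diagonal[OF assms(2,1)] region_swap by metis

lemma region_bounds:
  assumes f: "dyck_path m f" and g: "dyck_path m g" and "(i, j) \<in> region a m f g"
  shows "a \<le> i" "i < a + m" "a \<le> j" "j < a + m"
proof -
  obtain k where k: "0 < k" "k < 2 * m" "Suc (i + j) = 2 * a + k" "a + f k \<le> i" "a + g k \<le> j"
    using assms(3) by (auto simp: region_def)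
  show "a \<le> i" "a \<le> j" using k by auto
  \<comment> \<open>After \<open>k\<close> steps at most \<open>2 * m - k\<close> steps D remain,
    and \<open>d\<close> must still reach \<open>m\<close>. Applied to one boundary, this bounds the
    coordinate that belongs to the other.\<close>
  have up: "k \<le> d k + m" if d: "dyck_path m d" for d
  proof -
    have "m \<le> d l + (2 * m - l)" if "l \<le> 2 * m" for l
      using that
    proof (induction l rule: inc_induct)
      case base
      then show ?case using d by (simp add: dyck_path_def)
    next
      case (step l)
      then show ?case using dyck_path_step[OF d, of l] by linarith
    qed
    from this[of k] show ?thesis using k(2) by linarith
  qed
  show "i < a + m" "j < a + m" using up[OF f] up[OF g] k by linarith+
qed

text \<open>The edge starts on antidiagonal \<open>k\<close>, which also carries the left box in the
  sense of \<open>region\<close>; the right box belongs to \<open>k + 1\<close>. Membership changes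
  exactly if the northeast boundary makes a step D there or the southwest boundary a step U.\<close>

lemma region_vertical_edge:
  assumes f: "dyck_path m f" and g: "dyck_path m g"
  shows "((i, j) \<in> region a m f g) \<noteq> ((i, Suc j) \<in> region a m f g) \<longleftrightarrow>
    (\<exists>k<2 * m. i = a + f k \<and> i + Suc j = 2 * a + k \<and> f (Suc k) = Suc (f k)) \<or>
    (\<exists>k<2 * m. Suc j = a + g k \<and> i + Suc j = 2 * a + k \<and> g (Suc k) = g k)"
proof (cases "\<exists>k<2 * m. i + Suc j = 2 * a + k")
  case True
  then obtain k where k: "k < 2 * m" "i + Suc j = 2 * a + k" by blast
  note facts = dyck_path_step[OF f k(1)] dyck_path_step[OF g k(1)]
    dyck_path_bound[OF f, of k] dyck_path_bound[OF g, of k]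
    dyck_path_bound[OF f, of "Suc k"] dyck_path_bound[OF g, of "Suc k"]
  have left: "(i, j) \<in> region a m f g \<longleftrightarrow> 0 < k \<and> a + f k \<le> i \<and> a + g k \<le> j"
    using k by (subst region_iff[where k = k]) auto
  have right: "(i, Suc j) \<in> region a m f g \<longleftrightarrow>
      Suc k < 2 * m \<and> a + f (Suc k) \<le> i \<and> a + g (Suc k) \<le> Suc j"
    using k by (subst region_iff[where k = "Suc k"]) auto
  have "((i, j) \<in> region a m f g) \<noteq> ((i, Suc j) \<in> region a m f g) \<longleftrightarrow>
    i = a + f k \<and> f (Suc k) = Suc (f k) \<or> Suc j = a + g k \<and> g (Suc k) = g k"
  proof (cases "Suc k = 2 * m")
    \<comment> \<open>The right box now fails because its index is \<open>2 * m\<close>. Both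
      boundaries end with D, so only the northeast one runs along the vertical edge.\<close>
    case True
    note last = dyck_path_last[OF f True] dyck_path_last[OF g True]
    then have "f (Suc k) = Suc (f k)" "g (Suc k) = Suc (f k)" "g k = f k" "k = Suc (2 * f k)"
      using True by simp_all
    then show ?thesis using True k(2) unfolding left right by auto
  next
    case False
    then have "Suc k < 2 * m" using k(1) by simp
    with facts k(2) show ?thesis unfolding left right by (elim disjE; auto)
  qed
  also have "\<dots> \<longleftrightarrow>
    (\<exists>k<2 * m. i = a + f k \<and> i + Suc j = 2 * a + k \<and> f (Suc k) = Suc (f k)) \<or>
    (\<exists>k<2 * m. Suc j = a + g k \<and> i + Suc j = 2 * a + k \<and> g (Suc k) = g k)"
    using k by auto
  finally show ?thesis .
next
  case False
  have "(i, j) \<notin> region a m f g"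
    using False by (force simp: region_def)
  moreover have "(i, Suc j) \<notin> region a m f g"
  proof
    assume "(i, Suc j) \<in> region a m f g"
    then obtain k where "0 < k" "k < 2 * m" "Suc (i + Suc j) = 2 * a + k" by (auto simp: region_def)
    then show False using False by (cases k) auto
  qed
  ultimately show ?thesis using False by blast
qed

lemma region_horizontal_edge:
  assumes f: "dyck_path m f" and g: "dyck_path m g"
  shows "((i, j) \<in> region a m f g) \<noteq> ((Suc i, j) \<in> region a m f g) \<longleftrightarrow>
    (\<exists>k<2 * m. Suc i = a + f k \<and> Suc i + j = 2 * a + k \<and> f (Suc k) = f k) \<or>
    (\<exists>k<2 * m. j = a + g k \<and> Suc i + j = 2 * a + k \<and> g (Suc k) = Suc (g k))"
  using region_vertical_edge[OF g f, of j i a]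
  unfolding region_swap[of i j a m f g] region_swap[of "Suc i" j a m f g]
  by (simp add: add.commute disj_commute)

section \<open>Edges, points and enclosed boxes of a single loop\<close>

lemma vertical_edge_eq:
  "{(i, c), (Suc i, c)} = {(x, y), (Suc x, y)} \<longleftrightarrow> i = x \<and> c = y"
  "{(i, c), (Suc i, c)} \<noteq> {(x, y), (x, Suc y)}"
  by (auto simp: doubleton_eq_iff)

lemma horizontal_edge_eq:
  "{(i, c), (i, Suc c)} = {(x, y), (x, Suc y)} \<longleftrightarrow> i = x \<and> c = y"
  "{(i, c), (i, Suc c)} \<noteq> {(x, y), (Suc x, y)}"
  by (auto simp: doubleton_eq_iff)

context
  fixes n :: nat and \<gamma> :: dyck_loop and a m :: nat and f g :: "nat \<Rightarrow> nat"
  assumes loop: "is_loop n \<gamma>"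
  defines "a \<equiv> start \<gamma>" and "m \<equiv> stop \<gamma> - start \<gamma>"
    and "f \<equiv> downs (neb \<gamma>)" and "g \<equiv> downs (swb \<gamma>)"
begin

lemma loop_words: "dyck_word m (neb \<gamma>)" "dyck_word m (swb \<gamma>)" "0 < m" "1 \<le> a" "a + m \<le> n"
  using loop by (auto simp: is_loop_def m_def a_def)

lemma loop_paths: "dyck_path m f" "dyck_path m g"
  using loop_words by (simp_all add: f_def g_def dyck_path_downs)

lemma neb_vertex_eq: "k \<le> 2 * m \<Longrightarrow> neb_vertex \<gamma> k = (a + f k, a + (k - f k))"
  using count_take_U[OF loop_words(1)] by (simp add: neb_vertex_def f_def a_def downs_def)

lemma swb_vertex_eq: "k \<le> 2 * m \<Longrightarrow> swb_vertex \<gamma> k = (a + (k - g k), a + g k)"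
  using count_take_U[OF loop_words(2)] by (simp add: swb_vertex_def g_def a_def downs_def)

lemma neb_edge_eq:
  assumes "k < 2 * m"
  shows "{neb_vertex \<gamma> k, neb_vertex \<gamma> (Suc k)} =
    (if f (Suc k) = Suc (f k) then {(a + f k, a + (k - f k)), (Suc (a + f k), a + (k - f k))}
     else {(a + f k, a + (k - f k)), (a + f k, Suc (a + (k - f k)))})"
  using dyck_path_step[OF loop_paths(1) assms] dyck_path_bound[OF loop_paths(1), of k] assms
  by (auto simp: neb_vertex_eq Suc_diff_le)

lemma swb_edge_eq:
  assumes "k < 2 * m"
  shows "{swb_vertex \<gamma> k, swb_vertex \<gamma> (Suc k)} =
    (if g (Suc k) = Suc (g k) then {(a + (k - g k), a + g k), (a + (k - g k), Suc (a + g k))}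
     else {(a + (k - g k), a + g k), (Suc (a + (k - g k)), a + g k)})"
  using dyck_path_step[OF loop_paths(2) assms] dyck_path_bound[OF loop_paths(2), of k] assms
  by (auto simp: swb_vertex_eq Suc_diff_le)

lemma neb_edges_eq: "neb_edges \<gamma> = {{neb_vertex \<gamma> k, neb_vertex \<gamma> (Suc k)} | k. k < 2 * m}"
  using dyck_word_length[OF loop_words(1)] by (simp add: neb_edges_def)

lemma swb_edges_eq: "swb_edges \<gamma> = {{swb_vertex \<gamma> k, swb_vertex \<gamma> (Suc k)} | k. k < 2 * m}"
  using dyck_word_length[OF loop_words(2)] by (simp add: swb_edges_def)

text \<open>The coordinate sum of its first endpoint determines the index \<open>k\<close> of an
  edge. Using this sum in place of the second coordinate avoids truncated subtraction.\<close>

lemma neb_vertical: "{(i, c), (Suc i, c)} \<in> neb_edges \<gamma> \<longleftrightarrow>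
    (\<exists>k<2 * m. i = a + f k \<and> i + c = 2 * a + k \<and> f (Suc k) = Suc (f k))"
proof -
  have "{(i, c), (Suc i, c)} = {neb_vertex \<gamma> k, neb_vertex \<gamma> (Suc k)} \<longleftrightarrow>
    i = a + f k \<and> i + c = 2 * a + k \<and> f (Suc k) = Suc (f k)" if "k < 2 * m" for k
    unfolding neb_edge_eq[OF that]
    using dyck_path_bound[OF loop_paths(1), of k] that by (auto simp: vertical_edge_eq)
  then show ?thesis unfolding neb_edges_eq by blast
qed

lemma neb_horizontal: "{(i, c), (i, Suc c)} \<in> neb_edges \<gamma> \<longleftrightarrow>
    (\<exists>k<2 * m. i = a + f k \<and> i + c = 2 * a + k \<and> f (Suc k) = f k)"
proof -
  have "{(i, c), (i, Suc c)} = {neb_vertex \<gamma> k, neb_vertex \<gamma> (Suc k)} \<longleftrightarrow>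
    i = a + f k \<and> i + c = 2 * a + k \<and> f (Suc k) = f k" if "k < 2 * m" for k
    unfolding neb_edge_eq[OF that]
    using dyck_path_bound[OF loop_paths(1), of k] dyck_path_step[OF loop_paths(1) that] that
    by (auto simp: horizontal_edge_eq)
  then show ?thesis unfolding neb_edges_eq by blast
qed

lemma swb_vertical: "{(i, c), (Suc i, c)} \<in> swb_edges \<gamma> \<longleftrightarrow>
    (\<exists>k<2 * m. c = a + g k \<and> i + c = 2 * a + k \<and> g (Suc k) = g k)"
proof -
  have "{(i, c), (Suc i, c)} = {swb_vertex \<gamma> k, swb_vertex \<gamma> (Suc k)} \<longleftrightarrow>
    c = a + g k \<and> i + c = 2 * a + k \<and> g (Suc k) = g k" if "k < 2 * m" for k
    unfolding swb_edge_eq[OF that]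
    using dyck_path_bound[OF loop_paths(2), of k] dyck_path_step[OF loop_paths(2) that] that
    by (auto simp: vertical_edge_eq)
  then show ?thesis unfolding swb_edges_eq by blast
qed

lemma swb_horizontal: "{(i, c), (i, Suc c)} \<in> swb_edges \<gamma> \<longleftrightarrow>
    (\<exists>k<2 * m. c = a + g k \<and> i + c = 2 * a + k \<and> g (Suc k) = Suc (g k))"
proof -
  have "{(i, c), (i, Suc c)} = {swb_vertex \<gamma> k, swb_vertex \<gamma> (Suc k)} \<longleftrightarrow>
    c = a + g k \<and> i + c = 2 * a + k \<and> g (Suc k) = Suc (g k)" if "k < 2 * m" for k
    unfolding swb_edge_eq[OF that]
    using dyck_path_bound[OF loop_paths(2), of k] that by (auto simp: horizontal_edge_eq)
  then show ?thesis unfolding swb_edges_eq by blast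
qed

text \<open>Enclosure is defined by crossings of a row strip, the region by antidiagonals. On the
  antidiagonal of the box, the southwest boundary has already crossed the strip and the northeast
  boundary has not, which gives the two inequalities.\<close>

lemma enclosed_boxes_eq: "enclosed_boxes \<gamma> = region a m f g"
proof -
  have "(i, j) \<in> enclosed_boxes \<gamma> \<longleftrightarrow> (i, j) \<in> region a m f g" for i j
  proof
    assume "(i, j) \<in> enclosed_boxes \<gamma>"
    then obtain c c' where c: "c \<le> j" "{(i, c), (Suc i, c)} \<in> swb_edges \<gamma>"
      "j < c'" "{(i, c'), (Suc i, c')} \<in> neb_edges \<gamma>"
      by (auto simp: enclosed_boxes_def)
    obtain l where l: "l < 2 * m" "c = a + g l" "i + c = 2 * a + l" "g (Suc l) = g l"
      using c(2) unfolding swb_vertical by blast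
    obtain l' where l': "l' < 2 * m" "i = a + f l'" "i + c' = 2 * a + l'" "f (Suc l') = Suc (f l')"
      using c(4) unfolding neb_vertical by blast
    define k where "k = Suc (i + j) - 2 * a"
    have k: "Suc (i + j) = 2 * a + k" "Suc l \<le> k" "k \<le> l'"
      using c(1,3) l(3) l'(3) by (simp_all add: k_def)
    have "f k \<le> f l'" using dyck_path_mono[OF loop_paths(1) k(3)] l'(1) by simp
    moreover have "a + g k \<le> j"
    proof -
      \<comment> \<open>The number of steps U is monotone as well, and just after the crossing it is
        already \<open>i + 1 - a\<close>.\<close>
      have up: "p - g p \<le> q - g q" if "p \<le> q" "q \<le> 2 * m" for p q
        using that
      proof (induction q rule: dec_induct)
        case (step q)
        then show ?case
          using dyck_path_step[OF loop_paths(2), of q] dyck_path_bound[OF loop_paths(2), of q] by force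
      qed simp
      have "Suc l - g (Suc l) \<le> k - g k" using up[OF k(2)] k(3) l'(1) by simp
      then show ?thesis
        using l k dyck_path_bound[OF loop_paths(2), of l] dyck_path_bound[OF loop_paths(2), of k] l'(1)
        by linarith
    qed
    ultimately show "(i, j) \<in> region a m f g"
      unfolding region_iff[OF k(1)] using k l'(1,2) by linarith
  next
    assume "(i, j) \<in> region a m f g"
    then obtain k where k: "0 < k" "k < 2 * m" "Suc (i + j) = 2 * a + k" "a + f k \<le> i" "a + g k \<le> j"
      by (auto simp: region_def)
    have bounds: "i < a + m" "a \<le> i"
      using region_bounds[OF loop_paths \<open>(i, j) \<in> region a m f g\<close>] by auto
    have "f (2 * m) = m" using loop_paths(1) by (simp add: dyck_path_def)
    then have "f k \<le> i - a" "i - a < f (2 * m)" using k(4) bounds by auto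
    then obtain p where p: "k \<le> p" "p < 2 * m" "f p = i - a" "f (Suc p) = Suc (i - a)"
      using dyck_path_crossing[OF loop_paths(1), of k "2 * m" "i - a"] k(2) by auto
    \<comment> \<open>The column comes from the coordinate sum \<open>2 * a + p\<close>; since
      \<open>k \<le> p\<close>, it lies to the right of \<open>j\<close>.\<close>
    have neb: "{(i, 2 * a + p - i), (Suc i, 2 * a + p - i)} \<in> neb_edges \<gamma>"
      unfolding neb_vertical using p k bounds by (intro exI[of _ p]) auto
    \<comment> \<open>The crossing argument for steps U: the southwest boundary starts in row
      \<open>a \<le> i\<close> and is below row \<open>i\<close> at index \<open>k\<close>.\<close>
    have up: "\<exists>q<l. a + (q - g q) = i \<and> g (Suc q) = g q" if "i < a + (l - g l)" "l \<le> 2 * m" for l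
      using that
    proof (induction l)
      case 0
      then show ?case using bounds by simp
    next
      case (Suc l)
      show ?case
      proof (cases "i < a + (l - g l)")
        case True
        then show ?thesis using Suc by (meson Suc_leD less_SucI)
      next
        case False
        then show ?thesis
          using Suc.prems dyck_path_step[OF loop_paths(2), of l]
            dyck_path_bound[OF loop_paths(2), of l] by (intro exI[of _ l]) force
      qed
    qed
    have "i < a + (k - g k)"
      using k dyck_path_bound[OF loop_paths(2), of k] by linarith
    then obtain q where q: "q < k" "a + (q - g q) = i" "g (Suc q) = g q"
      using up[of k] k(2) by auto
    have swb: "{(i, a + g q), (Suc i, a + g q)} \<in> swb_edges \<gamma>"
      unfolding swb_vertical using q k(2) dyck_path_bound[OF loop_paths(2), of q]
      by (intro exI[of _ q]) auto
    have "a + g q \<le> j" using dyck_path_mono[OF loop_paths(2), of q k] q k by linarith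
    moreover have "j < 2 * a + p - i" using k(3) p(1) bounds by linarith
    ultimately show "(i, j) \<in> enclosed_boxes \<gamma>"
      using neb swb by (auto simp: enclosed_boxes_def)
  qed
  then show ?thesis by auto
qed

lemma diag_convex_enclosed: "diag_convex (enclosed_boxes \<gamma>)"
  unfolding enclosed_boxes_eq by (rule diag_convex_region[OF loop_paths])

lemma zero_outside_enclosed: "zero_outside n (box_ind (enclosed_boxes \<gamma>))"
  unfolding zero_outside_def
proof (intro allI impI)
  fix i j assume "box_ind (enclosed_boxes \<gamma>) i j \<noteq> 0"
  then have "(i, j) \<in> region a m f g" by (simp add: box_ind_def enclosed_boxes_eq split: if_splits)
  from region_bounds[OF loop_paths this] show "i \<in> {1..<n} \<and> j \<in> {1..<n}"
    using loop_words(4,5) by simp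
qed

text \<open>This and its horizontal counterpart translate statements about edges of loops into
  statements about boxes.\<close>

lemma vertical_loop_edge:
  "{(i, Suc j), (Suc i, Suc j)} \<in> loop_edges \<gamma> \<longleftrightarrow>
    ((i, j) \<in> enclosed_boxes \<gamma>) \<noteq> ((i, Suc j) \<in> enclosed_boxes \<gamma>)"
  unfolding loop_edges_def enclosed_boxes_eq region_vertical_edge[OF loop_paths] Un_iff
    neb_vertical swb_vertical ..

lemma horizontal_loop_edge:
  "{(Suc i, j), (Suc i, Suc j)} \<in> loop_edges \<gamma> \<longleftrightarrow>
    ((i, j) \<in> enclosed_boxes \<gamma>) \<noteq> ((Suc i, j) \<in> enclosed_boxes \<gamma>)"
  unfolding loop_edges_def enclosed_boxes_eq region_horizontal_edge[OF loop_paths] Un_iff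
    neb_horizontal swb_horizontal ..

lemma loop_edge_cases:
  assumes "e \<in> loop_edges \<gamma>"
  obtains i c where "e = {(i, c), (Suc i, c)}" | i c where "e = {(i, c), (i, Suc c)}"
proof -
  obtain k where "k < 2 * m" "e = {neb_vertex \<gamma> k, neb_vertex \<gamma> (Suc k)} \<or>
      e = {swb_vertex \<gamma> k, swb_vertex \<gamma> (Suc k)}"
    using assms unfolding loop_edges_def neb_edges_eq swb_edges_eq by blast
  then have "e \<in> {{(a + f k, a + (k - f k)), (Suc (a + f k), a + (k - f k))},
      {(a + f k, a + (k - f k)), (a + f k, Suc (a + (k - f k)))},
      {(a + (k - g k), a + g k), (a + (k - g k), Suc (a + g k))},
      {(a + (k - g k), a + g k), (Suc (a + (k - g k)), a + g k)}}"
    unfolding neb_edge_eq[OF \<open>k < 2 * m\<close>] swb_edge_eq[OF \<open>k < 2 * m\<close>] insert_iff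
    by presburger
  then show ?thesis
    by (elim insertE emptyE) (rule that(2) that(1), assumption)+
qed

lemma loop_points_eq: "loop_points \<gamma> = \<Union> (loop_edges \<gamma>)"
proof -
  have verts: "P ` {..2 * m} = \<Union> {{P k, P (Suc k)} | k. k < 2 * m}" for P :: "nat \<Rightarrow> point"
  proof (intro equalityI subsetI)
    fix v assume "v \<in> P ` {..2 * m}"
    then obtain k where k: "k \<le> 2 * m" "v = P k" by auto
    show "v \<in> \<Union> {{P k, P (Suc k)} | k. k < 2 * m}"
    proof (cases "k < 2 * m")
      case False
      \<comment> \<open>The final vertex starts no edge; an edge ends there because
        \<open>0 < m\<close>.\<close>
      then have "Suc (k - 1) = k" "k - 1 < 2 * m" using k loop_words(3) by auto
      then have "v \<in> {P (k - 1), P (Suc (k - 1))}" using k by simp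
      then show ?thesis using \<open>k - 1 < 2 * m\<close> by blast
    qed (use k in blast)
  next
    fix v assume "v \<in> \<Union> {{P k, P (Suc k)} | k. k < 2 * m}"
    then obtain k where "k < 2 * m" "v = P k \<or> v = P (Suc k)" by auto
    then show "v \<in> P ` {..2 * m}" by auto
  qed
  show ?thesis
    unfolding loop_points_def loop_edges_def dyck_word_length[OF loop_words(1)]
      dyck_word_length[OF loop_words(2)] verts neb_edges_eq swb_edges_eq by (rule Union_Un_distrib[symmetric])
qed

text \<open>A point is on the loop if one of its four incident edges is, that is, if its four boxes
  are not all inside or all outside.\<close>

lemma loop_points_iff: "(Suc i, Suc j) \<in> loop_points \<gamma> \<longleftrightarrow> on_border (enclosed_boxes \<gamma>) i j"
proof
  assume "(Suc i, Suc j) \<in> loop_points \<gamma>"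
  then obtain e where e: "e \<in> loop_edges \<gamma>" "(Suc i, Suc j) \<in> e" unfolding loop_points_eq by blast
  from loop_edge_cases[OF e(1)] show "on_border (enclosed_boxes \<gamma>) i j"
  proof cases
    case (1 x y)
    then have "x = Suc i \<and> y = Suc j \<or> x = i \<and> y = Suc j" using e(2) by auto
    then show ?thesis
      using e(1) vertical_loop_edge[of x j] unfolding 1 on_border_def by auto
  next
    case (2 x y)
    then have "x = Suc i \<and> y = Suc j \<or> x = Suc i \<and> y = j" using e(2) by auto
    then show ?thesis
      using e(1) horizontal_loop_edge[of i y] unfolding 2 on_border_def by auto
  qed
next
  assume "on_border (enclosed_boxes \<gamma>) i j"
  then consider "((i, j) \<in> enclosed_boxes \<gamma>) \<noteq> ((i, Suc j) \<in> enclosed_boxes \<gamma>)"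
    | "((Suc i, j) \<in> enclosed_boxes \<gamma>) \<noteq> ((Suc i, Suc j) \<in> enclosed_boxes \<gamma>)"
    | "((i, j) \<in> enclosed_boxes \<gamma>) \<noteq> ((Suc i, j) \<in> enclosed_boxes \<gamma>)"
    | "((i, Suc j) \<in> enclosed_boxes \<gamma>) \<noteq> ((Suc i, Suc j) \<in> enclosed_boxes \<gamma>)"
    unfolding on_border_def by blast
  then show "(Suc i, Suc j) \<in> loop_points \<gamma>"
    unfolding loop_points_eq vertical_loop_edge[symmetric] horizontal_loop_edge[symmetric]
    by cases blast+
qed

text \<open>Every osculation is therefore \<open>(Suc i, Suc j)\<close> with
  \<open>i, j < n\<close>, which is the range of the bilinear sums.\<close>

lemma loop_points_range:
  assumes "(i, j) \<in> loop_points \<gamma>"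
  shows "1 \<le> i" "i \<le> n" "1 \<le> j" "j \<le> n"
proof -
  have le: "count_list (take k w) x \<le> count_list w x" for k x and w :: "step list"
    using arg_cong[OF append_take_drop_id[of k w], of "\<lambda>w. count_list w x"]
    by (simp only: count_list_append)
  have "count_list (take k w) x \<le> m" if "dyck_word m w" for k x w
    using that le[of k w x] by (cases x) (simp_all add: dyck_word_def)
  then have "count_list (take k (neb \<gamma>)) x \<le> m" "count_list (take k (swb \<gamma>)) x \<le> m" for k x
    using loop_words by simp_all
  then have "\<exists>x y. x \<le> m \<and> y \<le> m \<and> (i, j) = (a + x, a + y)"
    using assms unfolding loop_points_def neb_vertex_def swb_vertex_def a_def by blast
  then show "1 \<le> i" "i \<le> n" "1 \<le> j" "j \<le> n" using loop_words(4,5) by auto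
qed

lemma loop_inv_eq:
  "loop_inv n \<gamma> = inv_linear n (box_ind (enclosed_boxes \<gamma>)) +
    inv_bilinear n (box_ind (enclosed_boxes \<gamma>)) (box_ind (enclosed_boxes \<gamma>))"
proof -
  obtain A where "asm n A" "dyck_island n A = box_ind (enclosed_boxes \<gamma>)"
    using ex_asm_box_ind[OF diag_convex_enclosed zero_outside_enclosed] by blast
  moreover have "(\<lambda>i j. if (i, j) \<in> enclosed_boxes \<gamma> then 1 else 0) = box_ind (enclosed_boxes \<gamma>)"
    by (intro ext) (simp add: box_ind_def)
  ultimately show ?thesis unfolding loop_inv_def by (simp only: island_inv_eq)
qed

end

section \<open>Summation over pairs of loops\<close>

lemma edge_disjoint_enclosed:
  assumes "is_loop n \<gamma>" "is_loop n \<gamma>'" "loop_edges \<gamma> \<inter> loop_edges \<gamma>' = {}"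
  shows "edge_disjoint (enclosed_boxes \<gamma>) (enclosed_boxes \<gamma>')"
proof -
  have "\<not> (e \<in> loop_edges \<gamma> \<and> e \<in> loop_edges \<gamma>')" for e using assms(3) by blast
  from this[of "{(i, Suc j), (Suc i, Suc j)}" for i j] this[of "{(Suc i, j), (Suc i, Suc j)}" for i j]
  show ?thesis
    unfolding edge_disjoint_def vertical_loop_edge[OF assms(1)] vertical_loop_edge[OF assms(2)]
      horizontal_loop_edge[OF assms(1)] horizontal_loop_edge[OF assms(2)] de_Morgan_conj not_not
    by (intro allI conjI)
qed

lemma sum_off_diagonal_swap:
  fixes F :: "'a \<Rightarrow> 'a \<Rightarrow> int"
  assumes "finite I"
  shows "(\<Sum>s\<in>I. \<Sum>t\<in>I - {s}. F s t) = (\<Sum>s\<in>I. \<Sum>t\<in>I - {s}. F t s)"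
proof -
  have "(\<Sum>s\<in>I. \<Sum>t\<in>I - {s}. G s t) = (\<Sum>s\<in>I. \<Sum>t\<in>I. G s t) - (\<Sum>s\<in>I. G s s)"
    for G :: "'a \<Rightarrow> 'a \<Rightarrow> int"
    using assms by (simp add: sum_diff1 sum_subtractf)
  from this[of F] this[of "\<lambda>s t. F t s"] show ?thesis
    using sum.swap[of F I I] by simp
qed

text \<open>At most two elements satisfy \<open>P\<close>, so there are either no ordered pairs of
  distinct ones or exactly two. This turns a count of pairs of loops into a count of points.\<close>

lemma sum_ordered_pairs:
  assumes "finite I"
    and at_most_two: "\<And>r s t. r \<in> I \<Longrightarrow> s \<in> I \<Longrightarrow> t \<in> I \<Longrightarrow> P r \<Longrightarrow> P s \<Longrightarrow> P t \<Longrightarrow>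
      r = s \<or> r = t \<or> s = t"
  shows "(\<Sum>s\<in>I. \<Sum>t\<in>I - {s}. of_bool (P s \<and> P t)) =
    (2 * of_bool (\<exists>s\<in>I. \<exists>t\<in>I. s \<noteq> t \<and> P s \<and> P t) :: int)"
proof (cases "\<exists>s\<in>I. \<exists>t\<in>I. s \<noteq> t \<and> P s \<and> P t")
  case True
  then obtain s t where st: "s \<in> I" "t \<in> I" "s \<noteq> t" "P s" "P t" by blast
  have M: "{x \<in> I. P x} = {s, t}" using st at_most_two by blast
  have "(\<Sum>x\<in>I. \<Sum>y\<in>I - {x}. of_bool (P x \<and> P y)) =
    (\<Sum>x\<in>I. if P x then int (card ({x \<in> I. P x} - {x})) else 0)"
  proof (intro sum.cong refl)
    fix x
    have "{y \<in> I - {x}. P y} = {x \<in> I. P x} - {x}" by auto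
    then show "(\<Sum>y\<in>I - {x}. of_bool (P x \<and> P y)) =
        (if P x then int (card ({x \<in> I. P x} - {x})) else 0)"
      using assms(1) by (simp add: of_bool_def sum.If_cases Int_def)
  qed
  also have "\<dots> = (\<Sum>x\<in>{x \<in> I. P x}. int (card ({x \<in> I. P x} - {x})))"
    by (rule sum.inter_filter[OF assms(1), symmetric])
  also have "\<dots> = 2" unfolding M using st(3) by (simp add: insert_Diff_if)
  finally show ?thesis using True by simp
next
  case False
  then have "(\<Sum>s\<in>I. \<Sum>t\<in>I - {s}. of_bool (P s \<and> P t)) = (0 :: int)"
    by (intro sum.neutral ballI) auto
  then show ?thesis using False by simp
qed

theorem mainTheorem1:
  fixes n :: nat and A :: "int mat" and \<Gamma> :: "dyck_loop set"
  assumes "asm n A"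
    and "boundary_loops n (dyck_island n A) \<Gamma>"
  shows "asm_inv n A = island_inv n (dyck_island n A) \<and>
    island_inv n (dyck_island n A) =
      (\<Sum>\<gamma>\<in>\<Gamma>. loop_inv n \<gamma>) - int (card (off_diagonal_osculations \<Gamma>))"
proof
  let ?e = "\<lambda>\<gamma>. box_ind (enclosed_boxes \<gamma>)"
  let ?B = "\<lambda>\<gamma> \<gamma>'. inv_bilinear n (?e \<gamma>) (?e \<gamma>')"
  let ?on = "\<lambda>\<gamma> v. on_border (enclosed_boxes \<gamma>) (fst v) (snd v)"
  \<comment> \<open>An element \<open>(i, j)\<close> of \<open>V\<close> stands for the lattice
    point \<open>(i + 1, j + 1)\<close>, whose NW box is \<open>(i, j)\<close>.\<close>
  define V where "V = {..<n} \<times> {..<n}"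
  define Q where "Q v \<longleftrightarrow> fst v \<noteq> snd v \<and> (\<exists>\<gamma>\<in>\<Gamma>. \<exists>\<gamma>'\<in>\<Gamma>. \<gamma> \<noteq> \<gamma>' \<and> ?on \<gamma> v \<and> ?on \<gamma>' v)" for v
  note props = assms(2)[unfolded boundary_loops_def]
  have fin: "finite \<Gamma>" using props by blast
  have loop: "is_loop n \<gamma>" if "\<gamma> \<in> \<Gamma>" for \<gamma> using props that by blast
  have island: "dyck_island n A i j = (\<Sum>\<gamma>\<in>\<Gamma>. ?e \<gamma> i j)" for i j
  proof -
    have "dyck_island n A i j = int (card {\<gamma> \<in> \<Gamma>. (i, j) \<in> enclosed_boxes \<gamma>})" using props by blast
    then show ?thesis using fin by (simp add: box_ind_def sum.If_cases Int_def)
  qed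
  have ed: "edge_disjoint (enclosed_boxes \<gamma>) (enclosed_boxes \<gamma>')"
    if "\<gamma> \<in> \<Gamma>" "\<gamma>' \<in> \<Gamma>" "\<gamma> \<noteq> \<gamma>'" for \<gamma> \<gamma>'
    using props that by (intro edge_disjoint_enclosed[of n] loop) blast+
  have nested: "enclosed_boxes \<gamma> \<subseteq> enclosed_boxes \<gamma>' \<or> enclosed_boxes \<gamma>' \<subseteq> enclosed_boxes \<gamma> \<or>
      enclosed_boxes \<gamma> \<inter> enclosed_boxes \<gamma>' = {}" if "\<gamma> \<in> \<Gamma>" "\<gamma>' \<in> \<Gamma>" for \<gamma> \<gamma>'
    using props that by blast
  show "asm_inv n A = island_inv n (dyck_island n A)"
    by (simp add: island_inv_eq[OF assms(1) refl] asm_inv_eq[OF assms(1)])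
  show "island_inv n (dyck_island n A) =
      (\<Sum>\<gamma>\<in>\<Gamma>. loop_inv n \<gamma>) - int (card (off_diagonal_osculations \<Gamma>))"
  proof -
    let ?E = "\<Sum>\<gamma>\<in>\<Gamma>. \<Sum>\<gamma>'\<in>\<Gamma> - {\<gamma>}. ?B \<gamma> \<gamma>'"
    have pair: "?B \<gamma> \<gamma>' + ?B \<gamma>' \<gamma> =
        - (\<Sum>v\<in>V. of_bool ((fst v \<noteq> snd v \<and> ?on \<gamma> v) \<and> (fst v \<noteq> snd v \<and> ?on \<gamma>' v)))"
      if "\<gamma> \<in> \<Gamma>" "\<gamma>' \<in> \<Gamma> - {\<gamma>}" for \<gamma> \<gamma>'
    proof -
      have "?B \<gamma> \<gamma>' + ?B \<gamma>' \<gamma> = - (\<Sum>i<n. \<Sum>j<n. of_bool (i \<noteq> j \<and>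
          on_border (enclosed_boxes \<gamma>) i j \<and> on_border (enclosed_boxes \<gamma>') i j))"
        using that loop ed nested
        by (intro inv_bilinear_pair) (auto intro: diag_convex_enclosed zero_outside_enclosed)
      also have "\<dots> = - (\<Sum>v\<in>V. of_bool (fst v \<noteq> snd v \<and> ?on \<gamma> v \<and> ?on \<gamma>' v))"
        unfolding V_def sum.cartesian_product by (simp add: case_prod_beta)
      \<comment> \<open>The off-diagonal condition is given to both loops to reach the form
        \<open>P s \<and> P t\<close> of \<open>sum_ordered_pairs\<close>.\<close>
      also have "\<dots> = - (\<Sum>v\<in>V. of_bool ((fst v \<noteq> snd v \<and> ?on \<gamma> v) \<and> (fst v \<noteq> snd v \<and> ?on \<gamma>' v)))"
        by (intro arg_cong[where f = uminus] sum.cong refl) auto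
      finally show ?thesis .
    qed
    \<comment> \<open>Exchanging the loops in one copy of \<open>?E\<close> produces the symmetrized
      terms. The factor 2 cancels later against the two orders of each osculating pair.\<close>
    have "2 * ?E = (\<Sum>\<gamma>\<in>\<Gamma>. \<Sum>\<gamma>'\<in>\<Gamma> - {\<gamma>}. ?B \<gamma> \<gamma>' + ?B \<gamma>' \<gamma>)"
      using sum_off_diagonal_swap[OF fin, of ?B] by (simp add: sum.distrib)
    also have "\<dots> = (\<Sum>\<gamma>\<in>\<Gamma>. \<Sum>\<gamma>'\<in>\<Gamma> - {\<gamma>}. - (\<Sum>v\<in>V.
        of_bool ((fst v \<noteq> snd v \<and> ?on \<gamma> v) \<and> (fst v \<noteq> snd v \<and> ?on \<gamma>' v))))"
      by (intro sum.cong refl pair)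
    also have "\<dots> = - (\<Sum>\<gamma>\<in>\<Gamma>. \<Sum>\<gamma>'\<in>\<Gamma> - {\<gamma>}. \<Sum>v\<in>V.
        of_bool ((fst v \<noteq> snd v \<and> ?on \<gamma> v) \<and> (fst v \<noteq> snd v \<and> ?on \<gamma>' v)))"
      by (simp only: sum_negf)
    also have "\<dots> = - (\<Sum>\<gamma>\<in>\<Gamma>. \<Sum>v\<in>V. \<Sum>\<gamma>'\<in>\<Gamma> - {\<gamma>}.
        of_bool ((fst v \<noteq> snd v \<and> ?on \<gamma> v) \<and> (fst v \<noteq> snd v \<and> ?on \<gamma>' v)))"
      by (intro arg_cong[where f = uminus] sum.cong refl sum.swap)
    also have "\<dots> = - (\<Sum>v\<in>V. \<Sum>\<gamma>\<in>\<Gamma>. \<Sum>\<gamma>'\<in>\<Gamma> - {\<gamma>}.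
        of_bool ((fst v \<noteq> snd v \<and> ?on \<gamma> v) \<and> (fst v \<noteq> snd v \<and> ?on \<gamma>' v)))"
      by (intro arg_cong[where f = uminus] sum.swap)
    also have "\<dots> = - (\<Sum>v\<in>V. 2 * of_bool (\<exists>\<gamma>\<in>\<Gamma>. \<exists>\<gamma>'\<in>\<Gamma>. \<gamma> \<noteq> \<gamma>' \<and>
        (fst v \<noteq> snd v \<and> ?on \<gamma> v) \<and> (fst v \<noteq> snd v \<and> ?on \<gamma>' v)))"
    proof (intro arg_cong[where f = uminus] sum.cong refl sum_ordered_pairs fin)
      fix v r s t
      assume *: "r \<in> \<Gamma>" "s \<in> \<Gamma>" "t \<in> \<Gamma>" "fst v \<noteq> snd v \<and> ?on r v" "fst v \<noteq> snd v \<and> ?on s v"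
        "fst v \<noteq> snd v \<and> ?on t v"
      show "r = s \<or> r = t \<or> s = t"
      proof (rule ccontr)
        assume "\<not> (r = s \<or> r = t \<or> s = t)"
        then show False
          using at_most_two_borders[OF ed ed ed, of r s t "fst v" "snd v"] * by simp
      qed
    qed
    also have "\<dots> = - 2 * (\<Sum>v\<in>V. of_bool (Q v))"
      unfolding sum_distrib_left[symmetric] Q_def
      by (simp, intro sum.cong refl arg_cong[where f = of_bool]) blast
    also have "(\<Sum>v\<in>V. of_bool (Q v)) = int (card {v \<in> V. Q v})"
      by (simp add: V_def of_bool_def sum.If_cases Int_def)
    also have "card {v \<in> V. Q v} = card (off_diagonal_osculations \<Gamma>)"
    proof -
      \<comment> \<open>The shift by one from NW boxes to lattice points is a bijection onto the
        osculations.\<close>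
      have "off_diagonal_osculations \<Gamma> = (\<lambda>(i, j). (Suc i, Suc j)) ` {v \<in> V. Q v}"
      proof (intro equalityI subsetI)
        fix w assume w: "w \<in> off_diagonal_osculations \<Gamma>"
        then obtain i j \<gamma> \<gamma>' where ij: "w = (i, j)" "i \<noteq> j" "\<gamma> \<in> \<Gamma>" "\<gamma>' \<in> \<Gamma>" "\<gamma> \<noteq> \<gamma>'"
          "(i, j) \<in> loop_points \<gamma>" "(i, j) \<in> loop_points \<gamma>'"
          unfolding off_diagonal_osculations_def by blast
        note range = loop_points_range[OF loop[OF ij(3)] ij(6)]
        obtain i' j' where ij': "i = Suc i'" "j = Suc j'"
          using range(1,3) by (cases i; cases j) auto
        have "on_border (enclosed_boxes \<gamma>) i' j'" "on_border (enclosed_boxes \<gamma>') i' j'"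
          using ij(6,7) loop_points_iff[OF loop] ij(3,4) unfolding ij' by blast+
        then have "Q (i', j')" unfolding Q_def using ij(2-5) ij' by auto
        moreover have "(i', j') \<in> V" using range(2,4) ij' by (simp add: V_def)
        ultimately show "w \<in> (\<lambda>(i, j). (Suc i, Suc j)) ` {v \<in> V. Q v}"
          using ij(1) ij' by force
      next
        fix w assume "w \<in> (\<lambda>(i, j). (Suc i, Suc j)) ` {v \<in> V. Q v}"
        then obtain i j where ij: "w = (Suc i, Suc j)" "Q (i, j)" by auto
        then obtain \<gamma> \<gamma>' where \<gamma>: "i \<noteq> j" "\<gamma> \<in> \<Gamma>" "\<gamma>' \<in> \<Gamma>" "\<gamma> \<noteq> \<gamma>'"
          "on_border (enclosed_boxes \<gamma>) i j" "on_border (enclosed_boxes \<gamma>') i j"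
          unfolding Q_def by auto
        then have "(Suc i, Suc j) \<in> loop_points \<gamma>" "(Suc i, Suc j) \<in> loop_points \<gamma>'"
          using loop_points_iff[OF loop] by blast+
        then show "w \<in> off_diagonal_osculations \<Gamma>"
          unfolding off_diagonal_osculations_def ij(1) using \<gamma>(1-4) by auto
      qed
      moreover have "inj_on (\<lambda>(i, j). (Suc i, Suc j)) {v \<in> V. Q v}" by (auto simp: inj_on_def)
      ultimately show ?thesis by (simp add: card_image)
    qed
    finally have E: "?E = - int (card (off_diagonal_osculations \<Gamma>))" by simp
    have eq: "dyck_island n A = (\<lambda>i j. \<Sum>\<gamma>\<in>\<Gamma>. ?e \<gamma> i j)" by (intro ext island)
    have "island_inv n (dyck_island n A) =
        inv_linear n (\<lambda>i j. \<Sum>\<gamma>\<in>\<Gamma>. ?e \<gamma> i j) +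
        inv_bilinear n (\<lambda>i j. \<Sum>\<gamma>\<in>\<Gamma>. ?e \<gamma> i j) (\<lambda>i j. \<Sum>\<gamma>\<in>\<Gamma>. ?e \<gamma> i j)"
      unfolding eq by (rule island_inv_eq[OF assms(1) eq])
    also have "\<dots> = (\<Sum>\<gamma>\<in>\<Gamma>. inv_linear n (?e \<gamma>)) + (\<Sum>\<gamma>\<in>\<Gamma>. \<Sum>\<gamma>'\<in>\<Gamma>. ?B \<gamma> \<gamma>')"
      unfolding inv_linear_sum inv_bilinear_sum ..
    \<comment> \<open>The diagonal terms join the linear part to form the inversion numbers of the
      single loops; the rest is the defect \<open>?E\<close>.\<close>
    also have "(\<Sum>\<gamma>\<in>\<Gamma>. \<Sum>\<gamma>'\<in>\<Gamma>. ?B \<gamma> \<gamma>') = (\<Sum>\<gamma>\<in>\<Gamma>. ?B \<gamma> \<gamma>) + ?E"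
      unfolding sum.distrib[symmetric] using fin by (intro sum.cong refl sum.remove)
    also have "(\<Sum>\<gamma>\<in>\<Gamma>. inv_linear n (?e \<gamma>)) + ((\<Sum>\<gamma>\<in>\<Gamma>. ?B \<gamma> \<gamma>) + ?E) =
        (\<Sum>\<gamma>\<in>\<Gamma>. inv_linear n (?e \<gamma>) + ?B \<gamma> \<gamma>) + ?E"
      by (simp add: sum.distrib)
    also have "(\<Sum>\<gamma>\<in>\<Gamma>. inv_linear n (?e \<gamma>) + ?B \<gamma> \<gamma>) = (\<Sum>\<gamma>\<in>\<Gamma>. loop_inv n \<gamma>)"
      by (intro sum.cong refl loop_inv_eq[symmetric] loop)
    finally show ?thesis unfolding E by simp
  qed
qed

end
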